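(* Let $p$ be an odd prime, let $N\geq 1$ be an integer, and let $r=r'p^N\in\mathbb{Z}_p$ with $r'\in\mathbb{Z}_p$, $|r'|_p=1$. Then there is an isomorphism of C$^*$-algebras $$A_r\cong HS(s),$$ where $HS(s)$ is the Hensel-Steinitz algebra corresponding to $s=p^N$.
   Context: $\mathbb{Z}_p$ is the ring of $p$-adic integers with $p$-adic norm $|\cdot|_p$. For $0\neq r\in\mathbb{Z}_p$, define $\alpha_r:C(\mathbb{Z}_p)\to C(\mathbb{Z}_p)$ by $(\alpha_rf)(x)=f(x/r)$ if $r\mid x$ and $(\alpha_rf)(x)=0$ otherwise. $A_r=C(\mathbb{Z}_p)\rtimes_{\alpha_r}\mathbb{N}$ is the universal unital C$^*$-algebra generated by a (unital) copy $\{M_f:f\in C(\mathbb{Z}_p)\}$ of $C(\mathbb{Z}_p)$ and an element $V_r$ satisfying $V_r^*V_r=I$ and $V_rM_fV_r^*=M_{\alpha_r(f)}$ for all $f\in C(\mathbb{Z}_p)$. For an integer $s>1$, $\mathbb{Z}_s:=\varprojlim\mathbb{Z}/s^n\mathbb{Z}$ (inverse limit along reduction maps), and $\alpha_s:C(\mathbb{Z}_s)\to C(\mathbb{Z}_s)$ is $(\alpha_sf)(x)=f(x/s)$ if $s\mid x$ and $0$ otherwise. The Hensel-Steinitz algebra $HS(s)=C(\mathbb{Z}_s)\rtimes_{\alpha_s}\mathbb{N}$ is the universal unital C$^*$-algebra generated by a (unital) copy $\{M_f:f\in C(\mathbb{Z}_s)\}$ of $C(\mathbb{Z}_s)$ and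 an element $V_s$ with $V_s^*V_s=I$ and $V_sM_fV_s^*=M_{\alpha_s(f)}$. *)

theory Defs
  imports
    "HOL-Analysis.Analysis"
    "HOL-Algebra.Module"
    "HOL-Library.Poly_Mapping"
    "HOL-Computational_Algebra.Primes"
begin

section \<open>Unital C*-algebras\<close>

record 'a cstar = "(complex, 'a) module" +
  cadj :: "'a \<Rightarrow> 'a"
  cnorm :: "'a \<Rightarrow> real"

locale cstar_algebra = ring A for A :: "('a, 'm) cstar_scheme" (structure) +
  assumes smult_closed: "x \<in> carrier A \<Longrightarrow> c \<odot> x \<in> carrier A"
    and smult_add_left: "x \<in> carrier A \<Longrightarrow> (c + d) \<odot> x = c \<odot> x \<oplus> d \<odot> x"
    and smult_add_right:
      "\<lbrakk>x \<in> carrier A; y \<in> carrier A\<rbrakk> \<Longrightarrow> c \<odot> (x \<oplus> y) = c \<odot> x \<oplus> c \<odot> y"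
    and smult_smult: "x \<in> carrier A \<Longrightarrow> c \<odot> (d \<odot> x) = (c * d) \<odot> x"
    and smult_one: "x \<in> carrier A \<Longrightarrow> 1 \<odot> x = x"
    and smult_mult_left:
      "\<lbrakk>x \<in> carrier A; y \<in> carrier A\<rbrakk> \<Longrightarrow> (c \<odot> x) \<otimes> y = c \<odot> (x \<otimes> y)"
    and smult_mult_right:
      "\<lbrakk>x \<in> carrier A; y \<in> carrier A\<rbrakk> \<Longrightarrow> x \<otimes> (c \<odot> y) = c \<odot> (x \<otimes> y)"
    and cadj_closed: "x \<in> carrier A \<Longrightarrow> cadj A x \<in> carrier A"
    and cadj_cadj: "x \<in> carrier A \<Longrightarrow> cadj A (cadj A x) = x"
    and cadj_add:
      "\<lbrakk>x \<in> carrier A; y \<in> carrier A\<rbrakk> \<Longrightarrow> cadj A (x \<oplus> y) = cadj A x \<oplus> cadj A y"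
    and cadj_smult: "x \<in> carrier A \<Longrightarrow> cadj A (c \<odot> x) = cnj c \<odot> cadj A x"
    and cadj_mult:
      "\<lbrakk>x \<in> carrier A; y \<in> carrier A\<rbrakk> \<Longrightarrow> cadj A (x \<otimes> y) = cadj A y \<otimes> cadj A x"
    and cnorm_nonneg: "x \<in> carrier A \<Longrightarrow> 0 \<le> cnorm A x"
    and cnorm_eq_0_iff: "x \<in> carrier A \<Longrightarrow> cnorm A x = 0 \<longleftrightarrow> x = \<zero>"
    and cnorm_triangle:
      "\<lbrakk>x \<in> carrier A; y \<in> carrier A\<rbrakk> \<Longrightarrow> cnorm A (x \<oplus> y) \<le> cnorm A x + cnorm A y"
    and cnorm_smult: "x \<in> carrier A \<Longrightarrow> cnorm A (c \<odot> x) = cmod c * cnorm A x"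
    and cnorm_mult:
      "\<lbrakk>x \<in> carrier A; y \<in> carrier A\<rbrakk> \<Longrightarrow> cnorm A (x \<otimes> y) \<le> cnorm A x * cnorm A y"
    and cstar_identity: "x \<in> carrier A \<Longrightarrow> cnorm A (cadj A x \<otimes> x) = (cnorm A x)\<^sup>2"
    and complete:
      "\<lbrakk>range u \<subseteq> carrier A; \<And>e. e > 0 \<Longrightarrow> \<exists>K. \<forall>m\<ge>K. \<forall>n\<ge>K. cnorm A (u m \<ominus> u n) < e\<rbrakk>
        \<Longrightarrow> \<exists>x\<in>carrier A. (\<lambda>n. cnorm A (u n \<ominus> x)) \<longlonglongrightarrow> 0"

definition star_hom ::
  "('a, 'm) cstar_scheme \<Rightarrow> ('b, 'n) cstar_scheme \<Rightarrow> ('a \<Rightarrow> 'b) set" where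
  "star_hom A B = {h \<in> ring_hom A B.
     (\<forall>c. \<forall>x\<in>carrier A. h (c \<odot>\<^bsub>A\<^esub> x) = c \<odot>\<^bsub>B\<^esub> h x) \<and>
     (\<forall>x\<in>carrier A. h (cadj A x) = cadj B (h x))}"

definition cstar_isomorphic ::
  "('a, 'm) cstar_scheme \<Rightarrow> ('b, 'n) cstar_scheme \<Rightarrow> bool" (infix "\<cong>\<^sub>C" 50) where
  "A \<cong>\<^sub>C B \<longleftrightarrow> cstar_algebra A \<and> cstar_algebra B \<and>
     (\<exists>h\<in>star_hom A B. bij_betw h (carrier A) (carrier B))"

text \<open>
  \<open>C(X)\<close> for a subset \<open>X\<close> of a topological space. HOL functions are total, so the elements
  are normalised to be \<open>0\<close> outside \<open>X\<close>; accordingly the unit is the indicator function of \<open>X\<close>.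
\<close>
definition cfun :: "'x::topological_space set \<Rightarrow> ('x \<Rightarrow> complex) cstar" where
  "cfun X = \<lparr>
     carrier = {f. continuous_on X f \<and> (\<forall>x. x \<notin> X \<longrightarrow> f x = 0)},
     mult = (\<lambda>f g x. f x * g x),
     one = (\<lambda>x. if x \<in> X then 1 else 0),
     zero = (\<lambda>x. 0),
     add = (\<lambda>f g x. f x + g x),
     smult = (\<lambda>c f x. c * f x),
     cadj = (\<lambda>f x. cnj (f x)),
     cnorm = (\<lambda>f. Sup ((\<lambda>x. cmod (f x)) ` X))\<rparr>"


section \<open>Universal C*-algebras\<close>

text \<open>Words in letters \<open>g\<close> (encoded as \<open>(g, False)\<close>) and \<open>g*\<close> (encoded as \<open>(g, True)\<close>).\<close>
datatype 'g star_word = Word (letters: "('g \<times> bool) list")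

instantiation star_word :: (type) monoid_add
begin

definition zero_star_word :: "'a star_word" where
  "zero_star_word = Word []"

definition plus_star_word :: "'a star_word \<Rightarrow> 'a star_word \<Rightarrow> 'a star_word" where
  "plus_star_word v w = Word (letters v @ letters w)"

instance
  by standard (simp_all add: zero_star_word_def plus_star_word_def)

end

text \<open>
  The free unital *-algebra is the complex monoid algebra of \<open>'g star_word\<close>, so its ring
  structure is the convolution product of \<open>HOL-Library.Poly_Mapping\<close>.
\<close>
type_synonym 'g free_star = "'g star_word \<Rightarrow>\<^sub>0 complex"

definition fgen :: "'g \<Rightarrow> 'g free_star" where
  "fgen g = Poly_Mapping.single (Word [(g, False)]) 1"

definition fscale :: "complex \<Rightarrow> 'g free_star \<Rightarrow> 'g free_star" where
  "fscale c x = Poly_Mapping.map ((*) c) x"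

definition word_adj :: "'g star_word \<Rightarrow> 'g star_word" where
  "word_adj w = Word (rev (map (\<lambda>(g, b). (g, \<not> b)) (letters w)))"

definition fadj :: "'g free_star \<Rightarrow> 'g free_star" where
  "fadj x = Poly_Mapping.map cnj (Poly_Mapping.map_key word_adj x)"

definition free_star_on :: "'g set \<Rightarrow> 'g free_star set" where
  "free_star_on G = {x. \<forall>w\<in>Poly_Mapping.keys x. fst ` set (letters w) \<subseteq> G}"

definition cstar_seminorm :: "'g set \<Rightarrow> 'g free_star set \<Rightarrow> ('g free_star \<Rightarrow> real) \<Rightarrow> bool" where
  "cstar_seminorm G R q \<longleftrightarrow>
     (\<forall>x\<in>free_star_on G. 0 \<le> q x) \<and>
     (\<forall>x\<in>free_star_on G. \<forall>y\<in>free_star_on G. q (x + y) \<le> q x + q y) \<and>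
     (\<forall>c. \<forall>x\<in>free_star_on G. q (fscale c x) = cmod c * q x) \<and>
     (\<forall>x\<in>free_star_on G. \<forall>y\<in>free_star_on G. q (x * y) \<le> q x * q y) \<and>
     (\<forall>x\<in>free_star_on G. q (fadj x * x) = (q x)\<^sup>2) \<and>
     (\<forall>x\<in>R. q x = 0)"

definition universal_seminorm :: "'g set \<Rightarrow> 'g free_star set \<Rightarrow> 'g free_star \<Rightarrow> real" where
  "universal_seminorm G R x = Sup {q x |q. cstar_seminorm G R q}"

definition cauchy_seqs :: "'g set \<Rightarrow> ('g free_star \<Rightarrow> real) \<Rightarrow> (nat \<Rightarrow> 'g free_star) set" where
  "cauchy_seqs G q = {u. range u \<subseteq> free_star_on G \<and>
     (\<forall>e>0. \<exists>K. \<forall>m\<ge>K. \<forall>n\<ge>K. q (u m - u n) < e)}"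

definition null_rel ::
  "'g set \<Rightarrow> ('g free_star \<Rightarrow> real) \<Rightarrow> ((nat \<Rightarrow> 'g free_star) \<times> (nat \<Rightarrow> 'g free_star)) set" where
  "null_rel G q = {(u, v). u \<in> cauchy_seqs G q \<and> v \<in> cauchy_seqs G q \<and>
     (\<lambda>n. q (u n - v n)) \<longlonglongrightarrow> 0}"

text \<open>The separated completion of the free *-algebra on \<open>G\<close> with respect to a seminorm.\<close>
definition free_completion ::
  "'g set \<Rightarrow> ('g free_star \<Rightarrow> real) \<Rightarrow> (nat \<Rightarrow> 'g free_star) set cstar" where
  "free_completion G q = (let E = null_rel G q in \<lparr>
     carrier = cauchy_seqs G q // E,
     mult = (\<lambda>X Y. \<Union>u\<in>X. \<Union>v\<in>Y. E `` {\<lambda>n. u n * v n}),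
     one = E `` {\<lambda>n. 1},
     zero = E `` {\<lambda>n. 0},
     add = (\<lambda>X Y. \<Union>u\<in>X. \<Union>v\<in>Y. E `` {\<lambda>n. u n + v n}),
     smult = (\<lambda>c X. \<Union>u\<in>X. E `` {\<lambda>n. fscale c (u n)}),
     cadj = (\<lambda>X. \<Union>u\<in>X. E `` {\<lambda>n. fadj (u n)}),
     cnorm = (\<lambda>X. THE l. \<forall>u\<in>X. (\<lambda>n. q (u n)) \<longlonglongrightarrow> l)\<rparr>)"

text \<open>
  The universal unital C*-algebra on generators \<open>G\<close> subject to the relations \<open>x = 0\<close> for
  \<open>x \<in> R\<close>: the completion of the free *-algebra in the largest C*-seminorm that
  annihilates \<open>R\<close>. It is meaningful when the C*-seminorms are pointwise bounded on \<open>G\<close>.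
\<close>
definition universal_cstar ::
  "'g set \<Rightarrow> 'g free_star set \<Rightarrow> (nat \<Rightarrow> 'g free_star) set cstar" where
  "universal_cstar G R = free_completion G (universal_seminorm G R)"

definition universal_gen ::
  "'g set \<Rightarrow> 'g free_star set \<Rightarrow> 'g \<Rightarrow> (nat \<Rightarrow> 'g free_star) set" where
  "universal_gen G R g = null_rel G (universal_seminorm G R) `` {\<lambda>n. fgen g}"


section \<open>Crossed products by an endomorphism\<close>

datatype 'f cp_gen = M 'f | V

definition cp_gens :: "('f, 'm) cstar_scheme \<Rightarrow> 'f cp_gen set" where
  "cp_gens C = insert V (M ` carrier C)"

text \<open>
  The first five families say that \<open>f \<mapsto> M f\<close> is a unital *-homomorphism; the last two are
  \<open>V* V = 1\<close> and \<open>V M\<^sub>f V* = M\<^bsub>\<alpha>(f)\<^esub>\<close>.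
\<close>
definition cp_rels :: "('f, 'm) cstar_scheme \<Rightarrow> ('f \<Rightarrow> 'f) \<Rightarrow> 'f cp_gen free_star set" where
  "cp_rels C \<alpha> =
     {fgen (M (f \<oplus>\<^bsub>C\<^esub> g)) - (fgen (M f) + fgen (M g)) |f g. f \<in> carrier C \<and> g \<in> carrier C} \<union>
     {fgen (M (f \<otimes>\<^bsub>C\<^esub> g)) - fgen (M f) * fgen (M g) |f g. f \<in> carrier C \<and> g \<in> carrier C} \<union>
     {fgen (M (c \<odot>\<^bsub>C\<^esub> f)) - fscale c (fgen (M f)) |c f. f \<in> carrier C} \<union>
     {fgen (M (cadj C f)) - fadj (fgen (M f)) |f. f \<in> carrier C} \<union>
     {fgen (M \<one>\<^bsub>C\<^esub>) - 1} \<union>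
     {fadj (fgen V) * fgen V - 1} \<union>
     {fgen V * fgen (M f) * fadj (fgen V) - fgen (M (\<alpha> f)) |f. f \<in> carrier C}"

definition crossed_product ::
  "('f, 'm) cstar_scheme \<Rightarrow> ('f \<Rightarrow> 'f) \<Rightarrow> (nat \<Rightarrow> 'f cp_gen free_star) set cstar" where
  "crossed_product C \<alpha> = universal_cstar (cp_gens C) (cp_rels C \<alpha>)"


section \<open>The rings \<open>\<int>\<^sub>s\<close>\<close>

text \<open>
  The inverse limit of the rings \<open>\<int>/s\<^sup>n\<int>\<close>, with residues represented in \<open>{0..<s\<^sup>n}\<close>. Its
  topology is the one induced by the product topology on \<open>nat \<Rightarrow> int\<close>, where \<open>int\<close> is
  discrete. For a prime \<open>s\<close> this is the ring of \<open>s\<close>-adic integers.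
\<close>
definition adic_ints :: "nat \<Rightarrow> (nat \<Rightarrow> int) ring" where
  "adic_ints s = \<lparr>
     carrier = {x. \<forall>n. 0 \<le> x n \<and> x n < int s ^ n \<and> x (Suc n) mod int s ^ n = x n},
     mult = (\<lambda>x y n. (x n * y n) mod int s ^ n),
     one = (\<lambda>n. 1 mod int s ^ n),
     zero = (\<lambda>n. 0),
     add = (\<lambda>x y n. (x n + y n) mod int s ^ n)\<rparr>"

definition adic_of_int :: "nat \<Rightarrow> int \<Rightarrow> nat \<Rightarrow> int" where
  "adic_of_int s k = (\<lambda>n. k mod int s ^ n)"

definition padic_norm :: "nat \<Rightarrow> (nat \<Rightarrow> int) \<Rightarrow> real" where
  "padic_norm p x =
     (if x = \<zero>\<^bsub>adic_ints p\<^esub> then 0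
      else (1 / real p) ^ (GREATEST k. \<exists>y\<in>carrier (adic_ints p).
        x = adic_of_int p (int p ^ k) \<otimes>\<^bsub>adic_ints p\<^esub> y))"

definition shift_endo ::
  "nat \<Rightarrow> (nat \<Rightarrow> int) \<Rightarrow> ((nat \<Rightarrow> int) \<Rightarrow> complex) \<Rightarrow> (nat \<Rightarrow> int) \<Rightarrow> complex" where
  "shift_endo s r f x =
     (if \<exists>y\<in>carrier (adic_ints s). x = r \<otimes>\<^bsub>adic_ints s\<^esub> y
      then f (THE y. y \<in> carrier (adic_ints s) \<and> x = r \<otimes>\<^bsub>adic_ints s\<^esub> y)
      else 0)"

type_synonym crossed_alg = "(nat \<Rightarrow> ((nat \<Rightarrow> int) \<Rightarrow> complex) cp_gen free_star) set cstar"

definition A_alg :: "nat \<Rightarrow> (nat \<Rightarrow> int) \<Rightarrow> crossed_alg" where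
  "A_alg p r = crossed_product (cfun (carrier (adic_ints p))) (shift_endo p r)"

definition HS :: "nat \<Rightarrow> crossed_alg" where
  "HS s = crossed_product (cfun (carrier (adic_ints s))) (shift_endo s (adic_of_int s (int s)))"

end

theory Submission
  imports Defs
begin

text \<open>
  Since \<open>|r'|\<^sub>p = 1\<close>, every \<open>x \<in> \<int>\<^sub>p\<close> has a unique expansion \<open>\<Sum> a\<^sub>i r\<^sup>i\<close> with digits \<open>0 \<le> a\<^sub>i < s = p\<^bsup>N\<^esup>\<close>,
  so \<open>\<Sum> a\<^sub>i s\<^sup>i \<mapsto> \<Sum> a\<^sub>i r\<^sup>i\<close> is a homeomorphism from \<open>\<int>\<^sub>s\<close> to \<open>\<int>\<^sub>p\<close> that carries multiplication by \<open>s\<close>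
  to multiplication by \<open>r\<close>. Pulling functions back along it intertwines \<open>\<alpha>\<^sub>r\<close> and \<open>\<alpha>\<^sub>s\<close>, hence
  relabels the generators and relations of one crossed product into those of the other and
  matches their C*-seminorms. The universal seminorms are finite because a real function of norm
  at most \<open>1\<close> is an average of two unitaries of \<open>C(X)\<close>.
\<close>

section \<open>The free *-algebra\<close>

text \<open>No representation of either algebra is constructed: an isometric relabelling of the free
  *-algebras extends to their completions by itself. Before that, the universal seminorm must be
  shown to be a C*-seminorm; it is a real supremum, which says nothing about an unbounded set. A
  bare C*-seminorm on the free *-algebra offers no functional calculus, so the bound has to start
  from elements whose norm the C*-identity controls directly, namely \<open>V\<close> and the
  unitaries of C(X). On the arithmetic side infinite digit sums are avoided by working modulo s^n.
  There the digit map is injective because r' is invertible modulo s^n, hence bijective because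
  there are finitely many residues. Since p^(N n) = s^n, level N n of Z_p corresponds to level n of
  Z_s, and these levels of Z_p determine its points.\<close>

lemma poly_mapping_single_induct [consumes 1, case_names zero add]:
  fixes x :: "'k \<Rightarrow>\<^sub>0 'b::monoid_add"
  assumes "Poly_Mapping.keys x \<subseteq> S"
    and "P 0"
    and "\<And>w c y. \<lbrakk>w \<in> S; Poly_Mapping.keys y \<subseteq> S; P y\<rbrakk> \<Longrightarrow> P (Poly_Mapping.single w c + y)"
  shows "P x"
proof -
  have "Poly_Mapping.keys x \<subseteq> S \<longrightarrow> P x"
  proof (induction x rule: Poly_Mapping.update_induct)
    case const
    show ?case using assms(2) by simp
  next
    case (update f a b)
    have "Poly_Mapping.update a b f = Poly_Mapping.single a b + f"
      using update by (intro poly_mapping_eqI)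
        (auto simp: lookup_update lookup_add lookup_single when_def in_keys_iff)
    moreover have "a \<in> S \<and> Poly_Mapping.keys f \<subseteq> S" if "Poly_Mapping.keys (Poly_Mapping.update a b f) \<subseteq> S"
      using that update by (auto simp: keys_update split: if_splits)
    ultimately show ?case
      using assms(3)[of a f b] update by auto
  qed
  with assms(1) show ?thesis by simp
qed

text \<open>Scaling becomes multiplication by a scalar sitting at the empty word. The laws of
  \<open>fscale\<close> below thus reduce to ring laws of the convolution product and to the
  centrality of such scalars.\<close>

lemma fscale_conv_mult: "fscale c x = Poly_Mapping.single 0 c * x"
  by (simp add: fscale_def mult_map_scale_conv_mult)

lemma single_zero_commute:
  fixes x :: "'a::monoid_add \<Rightarrow>\<^sub>0 complex"
  shows "x * Poly_Mapping.single 0 c = Poly_Mapping.single 0 c * x"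
proof -
  have "Poly_Mapping.keys x \<subseteq> UNIV" by simp
  then show ?thesis
    by (induction rule: poly_mapping_single_induct)
      (simp_all add: distrib_left distrib_right mult_single mult.commute)
qed

lemma fscale_single: "fscale c (Poly_Mapping.single w d) = Poly_Mapping.single w (c * d)"
  by (simp add: fscale_conv_mult mult_single)

lemma fscale_add: "fscale c (x + y) = fscale c x + fscale c y"
  by (simp add: fscale_conv_mult distrib_left)

lemma fscale_diff: "fscale c (x - y) = fscale c x - fscale c y"
  by (simp add: fscale_conv_mult right_diff_distrib)

lemma fscale_add_left: "fscale (c + d) x = fscale c x + fscale d x"
  by (simp add: fscale_conv_mult single_add distrib_right)

lemma fscale_fscale: "fscale c (fscale d x) = fscale (c * d) x"
  by (simp add: fscale_conv_mult mult_single flip: mult.assoc)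

lemma fscale_one [simp]: "fscale 1 x = x"
  by (simp add: fscale_conv_mult)

lemma fscale_zero [simp]: "fscale c 0 = 0" "fscale 0 x = 0"
  by (simp_all add: fscale_conv_mult)

lemma fscale_minus_one: "fscale (- 1) x = - x"
  by (simp add: fscale_conv_mult single_uminus)

lemma fscale_mult_left: "fscale c x * y = fscale c (x * y)"
  by (simp add: fscale_conv_mult mult.assoc)

lemma fscale_mult_right: "x * fscale c y = fscale c (x * y)"
  by (metis fscale_conv_mult mult.assoc single_zero_commute)

lemma word_adj_word_adj [simp]: "word_adj (word_adj w) = w"
  by (cases w) (simp add: word_adj_def rev_map comp_def case_prod_unfold)

lemma inj_word_adj: "inj word_adj"
  by (metis injI word_adj_word_adj)

lemma word_adj_add: "word_adj (v + w) = word_adj w + word_adj v"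
  by (simp add: word_adj_def plus_star_word_def)

lemma word_adj_zero [simp]: "word_adj 0 = 0"
  by (simp add: word_adj_def zero_star_word_def)

lemma letters_word_adj: "fst ` set (letters (word_adj w)) = fst ` set (letters w)"
  by (force simp: word_adj_def)

lemma lookup_fadj: "Poly_Mapping.lookup (fadj x) w = cnj (Poly_Mapping.lookup x (word_adj w))"
  unfolding fadj_def
  by (simp add: Poly_Mapping.map.rep_eq map_key.rep_eq inj_word_adj when_def)

lemma fadj_single: "fadj (Poly_Mapping.single w c) = Poly_Mapping.single (word_adj w) (cnj c)"
  by (intro poly_mapping_eqI) (metis complex_cnj_zero lookup_fadj lookup_single_eq lookup_single_not_eq word_adj_word_adj)

lemma fadj_add: "fadj (x + y) = fadj x + fadj y"
  by (intro poly_mapping_eqI) (simp add: lookup_fadj lookup_add)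

lemma fadj_diff: "fadj (x - y) = fadj x - fadj y"
  by (intro poly_mapping_eqI) (simp add: lookup_fadj lookup_minus)

lemma fadj_zero [simp]: "fadj 0 = 0"
  by (intro poly_mapping_eqI) (simp add: lookup_fadj)

lemma fadj_one [simp]: "fadj 1 = 1"
  using fadj_single[of 0 1] by simp

lemma fadj_fadj [simp]: "fadj (fadj x) = x"
  by (intro poly_mapping_eqI) (simp add: lookup_fadj)

lemma fadj_mult: "fadj (x * y) = fadj y * fadj x"
proof -
  have *: "fadj (Poly_Mapping.single w c * y) = fadj y * fadj (Poly_Mapping.single w c)" for w c
  proof -
    have "Poly_Mapping.keys y \<subseteq> UNIV" by simp
    then show ?thesis
      by (induction rule: poly_mapping_single_induct)
        (simp_all add: distrib_left distrib_right fadj_add mult_single fadj_single word_adj_add mult.commute)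
  qed
  have "Poly_Mapping.keys x \<subseteq> UNIV" by simp
  then show ?thesis
    by (induction rule: poly_mapping_single_induct) (simp_all add: distrib_left distrib_right fadj_add *)
qed

lemma fadj_fscale: "fadj (fscale c x) = fscale (cnj c) (fadj x)"
  by (simp add: fscale_conv_mult fadj_mult fadj_single single_zero_commute)

context
  fixes G :: "'g set"
begin

lemma free_star_on_keys: "x \<in> free_star_on G \<longleftrightarrow> Poly_Mapping.keys x \<subseteq> {w. fst ` set (letters w) \<subseteq> G}"
  by (auto simp: free_star_on_def)

lemma free_star_on_single: "fst ` set (letters w) \<subseteq> G \<Longrightarrow> Poly_Mapping.single w c \<in> free_star_on G"
  by (auto simp: free_star_on_def)

lemma free_star_on_fgen: "g \<in> G \<Longrightarrow> fgen g \<in> free_star_on G"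
  by (simp add: fgen_def free_star_on_single)

lemma free_star_on_zero [simp]: "0 \<in> free_star_on G"
  by (simp add: free_star_on_def)

lemma free_star_on_one [simp]: "1 \<in> free_star_on G"
  using free_star_on_single[of 0 1] by (simp flip: single_one add: zero_star_word_def)

lemma free_star_on_add: "\<lbrakk>x \<in> free_star_on G; y \<in> free_star_on G\<rbrakk> \<Longrightarrow> x + y \<in> free_star_on G"
  using Poly_Mapping.keys_add[of x y] by (auto simp: free_star_on_def)

lemma free_star_on_mult: "\<lbrakk>x \<in> free_star_on G; y \<in> free_star_on G\<rbrakk> \<Longrightarrow> x * y \<in> free_star_on G"
  unfolding free_star_on_def mem_Collect_eq
proof
  fix w
  assume x: "\<forall>w\<in>Poly_Mapping.keys x. fst ` set (letters w) \<subseteq> G"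
    and y: "\<forall>w\<in>Poly_Mapping.keys y. fst ` set (letters w) \<subseteq> G"
    and "w \<in> Poly_Mapping.keys (x * y)"
  then obtain u v where "w = u + v" "u \<in> Poly_Mapping.keys x" "v \<in> Poly_Mapping.keys y"
    using Poly_Mapping.keys_mult[of x y] by blast
  with x y show "fst ` set (letters w) \<subseteq> G"
    by (simp add: plus_star_word_def image_Un)
qed

lemma free_star_on_fscale: "x \<in> free_star_on G \<Longrightarrow> fscale c x \<in> free_star_on G"
  by (auto simp: fscale_conv_mult zero_star_word_def intro!: free_star_on_mult free_star_on_single)

lemma free_star_on_uminus: "x \<in> free_star_on G \<Longrightarrow> - x \<in> free_star_on G"
  using free_star_on_fscale[of x "-1"] by (simp add: fscale_minus_one)

lemma free_star_on_diff: "\<lbrakk>x \<in> free_star_on G; y \<in> free_star_on G\<rbrakk> \<Longrightarrow> x - y \<in> free_star_on G"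
  using free_star_on_add[of x "- y"] free_star_on_uminus by simp

lemma free_star_on_fadj: "x \<in> free_star_on G \<Longrightarrow> fadj x \<in> free_star_on G"
  unfolding free_star_on_def mem_Collect_eq
proof
  fix w
  assume x: "\<forall>w\<in>Poly_Mapping.keys x. fst ` set (letters w) \<subseteq> G" and "w \<in> Poly_Mapping.keys (fadj x)"
  then have "word_adj w \<in> Poly_Mapping.keys x"
    by (simp add: in_keys_iff lookup_fadj)
  with x show "fst ` set (letters w) \<subseteq> G"
    by (metis letters_word_adj)
qed

lemmas free_star_on_closed =
  free_star_on_add free_star_on_mult free_star_on_fscale free_star_on_uminus
  free_star_on_diff free_star_on_fadj

end

text \<open>Coefficients of words that \<open>\<sigma>\<close> identifies must add up, hence a sum
  of monomials and not a reindexing of the support: the maps used later are injective on the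
  relevant generators, but not on the whole type.\<close>

definition relabel :: "('g \<Rightarrow> 'h) \<Rightarrow> 'g free_star \<Rightarrow> 'h free_star" where
  "relabel \<sigma> x =
     (\<Sum>w\<in>Poly_Mapping.keys x. Poly_Mapping.single (map_star_word \<sigma> w) (Poly_Mapping.lookup x w))"

text \<open>Allows elements with different supports to be summed over one index set, as additivity
  requires.\<close>

lemma relabel_superset:
  assumes "finite S" "Poly_Mapping.keys x \<subseteq> S"
  shows "relabel \<sigma> x =
    (\<Sum>w\<in>S. Poly_Mapping.single (map_star_word \<sigma> w) (Poly_Mapping.lookup x w))"
  unfolding relabel_def using assms
  by (intro sum.mono_neutral_left) (auto simp: in_keys_iff)

lemma relabel_zero [simp]: "relabel \<sigma> 0 = 0"
  by (simp add: relabel_def)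

lemma relabel_single: "relabel \<sigma> (Poly_Mapping.single w c) = Poly_Mapping.single (map_star_word \<sigma> w) c"
  by (subst relabel_superset[of "{w}"]) auto

lemma relabel_add: "relabel \<sigma> (x + y) = relabel \<sigma> x + relabel \<sigma> y"
proof -
  let ?S = "Poly_Mapping.keys x \<union> Poly_Mapping.keys y"
  have "Poly_Mapping.keys (x + y) \<subseteq> ?S" by (rule Poly_Mapping.keys_add)
  then show ?thesis
    by (simp add: relabel_superset[of ?S] lookup_add single_add sum.distrib)
qed

lemma map_star_word_add: "map_star_word \<sigma> (v + w) = map_star_word \<sigma> v + map_star_word \<sigma> w"
  by (cases v; cases w) (simp add: plus_star_word_def)

lemma map_star_word_zero [simp]: "map_star_word \<sigma> 0 = 0"
  by (simp add: zero_star_word_def)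

lemma map_star_word_adj: "map_star_word \<sigma> (word_adj w) = word_adj (map_star_word \<sigma> w)"
  by (cases w) (simp add: word_adj_def rev_map comp_def case_prod_unfold)

lemma relabel_mult: "relabel \<sigma> (x * y) = relabel \<sigma> x * relabel \<sigma> y"
proof -
  have *: "relabel \<sigma> (Poly_Mapping.single w c * y) = relabel \<sigma> (Poly_Mapping.single w c) * relabel \<sigma> y" for w c
  proof -
    have "Poly_Mapping.keys y \<subseteq> UNIV" by simp
    then show ?thesis
      by (induction rule: poly_mapping_single_induct)
        (simp_all add: distrib_left relabel_add mult_single relabel_single map_star_word_add)
  qed
  have "Poly_Mapping.keys x \<subseteq> UNIV" by simp
  then show ?thesis
    by (induction rule: poly_mapping_single_induct) (simp_all add: distrib_right relabel_add *)
qed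

lemma relabel_one [simp]: "relabel \<sigma> 1 = 1"
  using relabel_single[of \<sigma> 0 1] by simp

lemma relabel_fscale: "relabel \<sigma> (fscale c x) = fscale c (relabel \<sigma> x)"
  by (simp add: fscale_conv_mult relabel_mult relabel_single)

lemma relabel_diff: "relabel \<sigma> (x - y) = relabel \<sigma> x - relabel \<sigma> y"
  by (metis add_diff_cancel_right' diff_add_cancel relabel_add)

lemma relabel_fadj: "relabel \<sigma> (fadj x) = fadj (relabel \<sigma> x)"
proof -
  have "Poly_Mapping.keys x \<subseteq> UNIV" by simp
  then show ?thesis
    by (induction rule: poly_mapping_single_induct)
      (simp_all add: relabel_add fadj_add fadj_single relabel_single map_star_word_adj)
qed

lemma relabel_fgen: "relabel \<sigma> (fgen g) = fgen (\<sigma> g)"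
  by (simp add: fgen_def relabel_single)

lemma free_star_on_relabel:
  assumes "\<sigma> ` G \<subseteq> H" "x \<in> free_star_on G"
  shows "relabel \<sigma> x \<in> free_star_on H"
proof -
  have "Poly_Mapping.single (map_star_word \<sigma> w) c \<in> free_star_on H"
    if "w \<in> {w. fst ` set (letters w) \<subseteq> G}" for w c
    using that assms(1) by (cases w) (force intro: free_star_on_single)
  with assms(2)[unfolded free_star_on_keys] show ?thesis
    by (induction rule: poly_mapping_single_induct) (auto simp: relabel_add relabel_single intro: free_star_on_add)
qed

lemma relabel_inverse:
  assumes "\<And>g. g \<in> G \<Longrightarrow> \<tau> (\<sigma> g) = g" "x \<in> free_star_on G"
  shows "relabel \<tau> (relabel \<sigma> x) = x"
proof -
  have "map_star_word \<tau> (map_star_word \<sigma> w) = w" if "w \<in> {w. fst ` set (letters w) \<subseteq> G}" for w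
    using that assms(1) by (cases w) (auto intro!: map_idI)
  with assms(2)[unfolded free_star_on_keys] show ?thesis
    by (induction rule: poly_mapping_single_induct) (auto simp: relabel_add relabel_single)
qed

section \<open>Completion of a C*-seminorm\<close>

locale free_star_seminorm =
  fixes G :: "'g set" and q :: "'g free_star \<Rightarrow> real"
  assumes nonneg: "x \<in> free_star_on G \<Longrightarrow> 0 \<le> q x"
    and triangle: "\<lbrakk>x \<in> free_star_on G; y \<in> free_star_on G\<rbrakk> \<Longrightarrow> q (x + y) \<le> q x + q y"
    and scale: "x \<in> free_star_on G \<Longrightarrow> q (fscale c x) = cmod c * q x"
    and submult: "\<lbrakk>x \<in> free_star_on G; y \<in> free_star_on G\<rbrakk> \<Longrightarrow> q (x * y) \<le> q x * q y"
    and cstar: "x \<in> free_star_on G \<Longrightarrow> q (fadj x * x) = (q x)\<^sup>2"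
begin

lemma zero [simp]: "q 0 = 0"
  using scale[of 0 0] by simp

lemma uminus: "x \<in> free_star_on G \<Longrightarrow> q (- x) = q x"
  using scale[of x "-1"] by (simp add: fscale_minus_one)

lemma diff_commute: "\<lbrakk>x \<in> free_star_on G; y \<in> free_star_on G\<rbrakk> \<Longrightarrow> q (x - y) = q (y - x)"
  using uminus[of "x - y"] by (simp add: free_star_on_closed)

lemma triangle_diff:
  "\<lbrakk>x \<in> free_star_on G; y \<in> free_star_on G; z \<in> free_star_on G\<rbrakk> \<Longrightarrow> q (x - z) \<le> q (x - y) + q (y - z)"
  using triangle[of "x - y" "y - z"] by (simp add: free_star_on_closed)

lemma abs_diff_le:
  assumes "x \<in> free_star_on G" "y \<in> free_star_on G"
  shows "\<bar>q x - q y\<bar> \<le> q (x - y)"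
  using triangle_diff[of x y 0] triangle_diff[of y x 0] diff_commute[of x y] assms by simp

text \<open>The C*-identity and submultiplicativity give
  \<open>(q x)\<^sup>2 \<le> q (fadj x) * q x\<close>. Cancelling \<open>q x\<close> yields one
  inequality, and the same applied to the adjoint yields the other.\<close>

lemma adj:
  assumes "x \<in> free_star_on G" shows "q (fadj x) = q x"
proof -
  have le: "q x \<le> q (fadj x)" if x: "x \<in> free_star_on G" for x
  proof (cases "q x = 0")
    case False
    have "q x * q x \<le> q (fadj x) * q x"
      using cstar[OF x] submult[of "fadj x" x] x by (simp add: free_star_on_closed power2_eq_square)
    then show ?thesis
      using False nonneg[OF x] by simp
  qed (use nonneg[of "fadj x"] x in \<open>simp add: free_star_on_closed\<close>)
  from le[OF assms] le[of "fadj x"] assms show ?thesis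
    by (simp add: free_star_on_closed)
qed

section \<open>Cauchy sequences for a C*-seminorm\<close>

abbreviation "\<C> \<equiv> cauchy_seqs G q"
abbreviation "\<E> \<equiv> null_rel G q"
abbreviation "\<A> \<equiv> free_completion G q"
abbreviation cls :: "(nat \<Rightarrow> 'g free_star) \<Rightarrow> (nat \<Rightarrow> 'g free_star) set"
  where "cls u \<equiv> \<E> `` {u}"

lemma cauchy_mem: "u \<in> \<C> \<Longrightarrow> u n \<in> free_star_on G"
  by (auto simp: cauchy_seqs_def)

lemma cauchyD: "\<lbrakk>u \<in> \<C>; e > 0\<rbrakk> \<Longrightarrow> \<exists>K. \<forall>m\<ge>K. \<forall>n\<ge>K. q (u m - u n) < e"
  by (auto simp: cauchy_seqs_def)

lemma cauchyI:
  assumes "\<And>n. u n \<in> free_star_on G" "\<And>e. e > 0 \<Longrightarrow> \<exists>K. \<forall>m\<ge>K. \<forall>n\<ge>K. q (u m - u n) < e"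
  shows "u \<in> \<C>"
  using assms by (auto simp: cauchy_seqs_def)

lemma cauchy_const: "x \<in> free_star_on G \<Longrightarrow> (\<lambda>_. x) \<in> \<C>"
  by (rule cauchyI) auto

lemma convergent_cauchy:
  assumes "u \<in> \<C>" shows "convergent (\<lambda>n. q (u n))"
proof (rule real_Cauchy_convergent, rule metric_CauchyI)
  fix e :: real assume "e > 0"
  then obtain K where K: "\<forall>m\<ge>K. \<forall>n\<ge>K. q (u m - u n) < e"
    using cauchyD assms by meson
  have "dist (q (u m)) (q (u n)) < e" if "m \<ge> K" "n \<ge> K" for m n
  proof -
    have "dist (q (u m)) (q (u n)) \<le> q (u m - u n)"
      unfolding dist_real_def using assms by (intro abs_diff_le cauchy_mem)
    with K that show ?thesis by force
  qed
  then show "\<exists>K. \<forall>m\<ge>K. \<forall>n\<ge>K. dist (q (u m)) (q (u n)) < e" by blast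
qed

lemma cauchy_bounded:
  assumes "u \<in> \<C>" obtains B where "B > 0" "\<And>n. q (u n) \<le> B"
proof -
  have "Bseq (\<lambda>n. q (u n))"
    using assms by (intro convergent_imp_Bseq convergent_cauchy)
  then obtain B where "B > 0" "\<And>n. norm (q (u n)) \<le> B"
    by (auto simp: Bseq_def)
  then show ?thesis by (intro that[of B]) (auto simp: abs_le_iff)
qed

lemma cauchy_add:
  assumes u: "u \<in> \<C>" and v: "v \<in> \<C>" shows "(\<lambda>n. u n + v n) \<in> \<C>"
proof (rule cauchyI)
  fix e :: real assume "e > 0"
  then obtain K L where K: "\<forall>m\<ge>K. \<forall>n\<ge>K. q (u m - u n) < e/2" and L: "\<forall>m\<ge>L. \<forall>n\<ge>L. q (v m - v n) < e/2"
    using cauchyD[OF u, of "e/2"] cauchyD[OF v, of "e/2"] by auto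
  have "q ((u m + v m) - (u n + v n)) < e" if "m \<ge> max K L" "n \<ge> max K L" for m n
  proof -
    have "q ((u m - u n) + (v m - v n)) \<le> q (u m - u n) + q (v m - v n)"
      using u v by (intro triangle free_star_on_closed cauchy_mem)
    moreover have "q (u m - u n) < e/2" "q (v m - v n) < e/2"
      using K L that by auto
    ultimately show ?thesis by (simp add: algebra_simps)
  qed
  then show "\<exists>K. \<forall>m\<ge>K. \<forall>n\<ge>K. q ((u m + v m) - (u n + v n)) < e" by blast
qed (use u v in \<open>intro free_star_on_closed cauchy_mem\<close>)

text \<open>One estimate for two purposes: products of Cauchy sequences are Cauchy, and the product
  of classes is independent of the representatives.\<close>

lemma mult_diff_le:
  assumes "x \<in> free_star_on G" "x' \<in> free_star_on G" "y \<in> free_star_on G" "y' \<in> free_star_on G"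
  shows "q (x * y - x' * y') \<le> q x * q (y - y') + q (x - x') * q y'"
proof -
  have "q (x * y - x' * y') = q (x * (y - y') + (x - x') * y')"
    by (simp add: algebra_simps)
  also have "\<dots> \<le> q (x * (y - y')) + q ((x - x') * y')"
    using assms by (intro triangle free_star_on_closed)
  also have "\<dots> \<le> q x * q (y - y') + q (x - x') * q y'"
    using assms by (intro add_mono submult free_star_on_closed)
  finally show ?thesis .
qed

lemma cauchy_mult:
  assumes u: "u \<in> \<C>" and v: "v \<in> \<C>" shows "(\<lambda>n. u n * v n) \<in> \<C>"
proof (rule cauchyI)
  fix e :: real assume "e > 0"
  obtain B where B: "B > 0" "\<And>n. q (u n) \<le> B" using cauchy_bounded[OF u] by metis
  obtain D where D: "D > 0" "\<And>n. q (v n) \<le> D" using cauchy_bounded[OF v] by metis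
  obtain K L where K: "\<forall>m\<ge>K. \<forall>n\<ge>K. q (u m - u n) < e/(2*D)" and L: "\<forall>m\<ge>L. \<forall>n\<ge>L. q (v m - v n) < e/(2*B)"
    using cauchyD[OF u, of "e/(2*D)"] cauchyD[OF v, of "e/(2*B)"] B D \<open>e > 0\<close> by auto
  have "q (u m * v m - u n * v n) < e" if "m \<ge> max K L" "n \<ge> max K L" for m n
  proof -
    have "q (u m * v m - u n * v n) \<le> q (u m) * q (v m - v n) + q (u m - u n) * q (v n)"
      using u v by (intro mult_diff_le cauchy_mem)
    also have "\<dots> \<le> B * q (v m - v n) + q (u m - u n) * D"
      using B D u v by (intro add_mono mult_mono nonneg free_star_on_closed cauchy_mem) auto
    also have "\<dots> < B * (e/(2*B)) + (e/(2*D)) * D"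
      using K L that B D by (intro add_strict_mono mult_strict_left_mono mult_strict_right_mono) auto
    also have "\<dots> = e" using B D by (simp add: field_simps)
    finally show ?thesis .
  qed
  then show "\<exists>K. \<forall>m\<ge>K. \<forall>n\<ge>K. q (u m * v m - u n * v n) < e" by blast
qed (use u v in \<open>intro free_star_on_closed cauchy_mem\<close>)

lemma cauchy_fscale:
  assumes u: "u \<in> \<C>" shows "(\<lambda>n. fscale c (u n)) \<in> \<C>"
proof -
  have "(\<lambda>n. fscale c 1 * u n) \<in> \<C>"
    using u by (intro cauchy_mult cauchy_const free_star_on_closed) simp
  then show ?thesis by (simp add: fscale_mult_left)
qed

lemma cauchy_uminus: "u \<in> \<C> \<Longrightarrow> (\<lambda>n. - u n) \<in> \<C>"
  using cauchy_fscale[of u "-1"] by (simp add: fscale_minus_one)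

lemma cauchy_diff: "\<lbrakk>u \<in> \<C>; v \<in> \<C>\<rbrakk> \<Longrightarrow> (\<lambda>n. u n - v n) \<in> \<C>"
  using cauchy_add[OF _ cauchy_uminus, of u v] by simp

lemma cauchy_fadj:
  assumes u: "u \<in> \<C>" shows "(\<lambda>n. fadj (u n)) \<in> \<C>"
proof (rule cauchyI)
  fix e :: real assume "e > 0"
  have "q (fadj (u m) - fadj (u n)) = q (u m - u n)" for m n
    using adj[of "u m - u n"] cauchy_mem[OF u] by (simp add: fadj_diff free_star_on_closed)
  with cauchyD[OF u \<open>e > 0\<close>] show "\<exists>K. \<forall>m\<ge>K. \<forall>n\<ge>K. q (fadj (u m) - fadj (u n)) < e" by simp
qed (use u in \<open>intro free_star_on_closed cauchy_mem\<close>)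

lemmas cauchy_closed =
  cauchy_add cauchy_mult cauchy_fscale cauchy_uminus cauchy_diff cauchy_fadj

lemma null_tendsto_sandwich:
  assumes "\<And>n. u n \<in> free_star_on G" "\<And>n. q (u n) \<le> f n" "f \<longlonglongrightarrow> 0"
  shows "(\<lambda>n. q (u n)) \<longlonglongrightarrow> 0"
  using assms by (intro tendsto_sandwich[OF _ _ tendsto_const assms(3)]) (simp_all add: nonneg)

lemma equiv_null: "equiv \<C> \<E>"
proof (rule equivI)
  show "\<E> \<subseteq> \<C> \<times> \<C>" "refl_on \<C> \<E>"
    by (auto simp: refl_on_def null_rel_def)
  show "sym \<E>"
  proof (rule symI)
    fix u v assume "(u, v) \<in> \<E>"
    moreover from this have "q (u n - v n) = q (v n - u n)" for n
      by (intro diff_commute cauchy_mem) (auto simp: null_rel_def)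
    ultimately show "(v, u) \<in> \<E>" by (simp add: null_rel_def)
  qed
  show "trans \<E>"
  proof (rule transI)
    fix u v w assume "(u, v) \<in> \<E>" "(v, w) \<in> \<E>"
    then have C: "u \<in> \<C>" "v \<in> \<C>" "w \<in> \<C>"
      and *: "(\<lambda>n. q (u n - v n)) \<longlonglongrightarrow> 0" "(\<lambda>n. q (v n - w n)) \<longlonglongrightarrow> 0"
      by (auto simp: null_rel_def)
    have "(\<lambda>n. q (u n - w n)) \<longlonglongrightarrow> 0"
    proof (rule null_tendsto_sandwich)
      show "q (u n - w n) \<le> q (u n - v n) + q (v n - w n)" for n
        using C by (intro triangle_diff cauchy_mem)
      show "(\<lambda>n. q (u n - v n) + q (v n - w n)) \<longlonglongrightarrow> 0"
        using tendsto_add[OF *] by simp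
    qed (use C in \<open>intro free_star_on_closed cauchy_mem\<close>)
    with C show "(u, w) \<in> \<E>" by (simp add: null_rel_def)
  qed
qed

section \<open>The quotient by null sequences as a C*-algebra\<close>

lemma cls_eqI:
  "\<lbrakk>u \<in> \<C>; v \<in> \<C>; (\<lambda>n. q (u n - v n)) \<longlonglongrightarrow> 0\<rbrakk> \<Longrightarrow> cls u = cls v"
  by (intro equiv_class_eq[OF equiv_null]) (simp add: null_rel_def)

lemma carrier_iff: "X \<in> carrier \<A> \<longleftrightarrow> (\<exists>u\<in>\<C>. X = cls u)"
  by (auto simp: free_completion_def Let_def quotient_def)

lemma carrierE:
  assumes "X \<in> carrier \<A>" obtains u where "u \<in> \<C>" "X = cls u"
  using assms carrier_iff by blast

lemma cls_carrier: "u \<in> \<C> \<Longrightarrow> cls u \<in> carrier \<A>"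
  using carrier_iff by blast

lemma one_cls: "\<one>\<^bsub>\<A>\<^esub> = cls (\<lambda>_. 1)" and zero_cls: "\<zero>\<^bsub>\<A>\<^esub> = cls (\<lambda>_. 0)"
  by (simp_all add: free_completion_def Let_def)

text \<open>\<open>free_completion\<close> defines its operations as unions over all
  representatives. Congruence modulo null sequences collapses such a union to a single class, so
  that this operation, and likewise the ones below, can be computed termwise.\<close>

lemma add_cls:
  assumes u: "u \<in> \<C>" and v: "v \<in> \<C>"
  shows "cls u \<oplus>\<^bsub>\<A>\<^esub> cls v = cls (\<lambda>n. u n + v n)"
proof -
  have "congruent2 \<E> \<E> (\<lambda>u v. cls (\<lambda>n. u n + v n))"
  proof (rule congruent2I')
    fix u u' v v' assume "(u, u') \<in> \<E>" "(v, v') \<in> \<E>"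
    then have C: "u \<in> \<C>" "u' \<in> \<C>" "v \<in> \<C>" "v' \<in> \<C>"
      and *: "(\<lambda>n. q (u n - u' n)) \<longlonglongrightarrow> 0" "(\<lambda>n. q (v n - v' n)) \<longlonglongrightarrow> 0"
      by (auto simp: null_rel_def)
    have "(\<lambda>n. q (u n + v n - (u' n + v' n))) \<longlonglongrightarrow> 0"
    proof (rule null_tendsto_sandwich)
      show "q (u n + v n - (u' n + v' n)) \<le> q (u n - u' n) + q (v n - v' n)" for n
        using triangle[of "u n - u' n" "v n - v' n"] C
        by (simp add: add_diff_add cauchy_mem free_star_on_closed)
      show "(\<lambda>n. q (u n - u' n) + q (v n - v' n)) \<longlonglongrightarrow> 0"
        using tendsto_add[OF *] by simp
    qed (use C in \<open>intro free_star_on_closed cauchy_mem\<close>)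
    with C show "cls (\<lambda>n. u n + v n) = cls (\<lambda>n. u' n + v' n)"
      by (intro cls_eqI cauchy_closed)
  qed
  from UN_equiv_class2[OF equiv_null equiv_null this u v] show ?thesis
    by (simp add: free_completion_def Let_def)
qed

lemma mult_cls:
  assumes u: "u \<in> \<C>" and v: "v \<in> \<C>"
  shows "cls u \<otimes>\<^bsub>\<A>\<^esub> cls v = cls (\<lambda>n. u n * v n)"
proof -
  have "congruent2 \<E> \<E> (\<lambda>u v. cls (\<lambda>n. u n * v n))"
  proof (rule congruent2I')
    fix u u' v v' assume "(u, u') \<in> \<E>" "(v, v') \<in> \<E>"
    then have C: "u \<in> \<C>" "u' \<in> \<C>" "v \<in> \<C>" "v' \<in> \<C>"
      and *: "(\<lambda>n. q (u n - u' n)) \<longlonglongrightarrow> 0" "(\<lambda>n. q (v n - v' n)) \<longlonglongrightarrow> 0"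
      by (auto simp: null_rel_def)
    obtain B where B: "B > 0" "\<And>n. q (u n) \<le> B" using cauchy_bounded[OF C(1)] by metis
    obtain D where D: "D > 0" "\<And>n. q (v' n) \<le> D" using cauchy_bounded[OF C(4)] by metis
    have "(\<lambda>n. q (u n * v n - u' n * v' n)) \<longlonglongrightarrow> 0"
    proof (rule null_tendsto_sandwich)
      fix n
      have "q (u n * v n - u' n * v' n) \<le> q (u n) * q (v n - v' n) + q (u n - u' n) * q (v' n)"
        using C by (intro mult_diff_le cauchy_mem)
      also have "\<dots> \<le> B * q (v n - v' n) + q (u n - u' n) * D"
        using B D C by (intro add_mono mult_mono nonneg free_star_on_closed cauchy_mem) auto
      finally show "q (u n * v n - u' n * v' n) \<le> B * q (v n - v' n) + q (u n - u' n) * D" .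
    next
      show "(\<lambda>n. B * q (v n - v' n) + q (u n - u' n) * D) \<longlonglongrightarrow> 0"
        using tendsto_add[OF tendsto_mult_left[OF *(2), of B] tendsto_mult_right[OF *(1), of D]] by simp
    qed (use C in \<open>intro free_star_on_closed cauchy_mem\<close>)
    with C show "cls (\<lambda>n. u n * v n) = cls (\<lambda>n. u' n * v' n)"
      by (intro cls_eqI cauchy_closed)
  qed
  from UN_equiv_class2[OF equiv_null equiv_null this u v] show ?thesis
    by (simp add: free_completion_def Let_def)
qed

lemma smult_cls:
  assumes u: "u \<in> \<C>"
  shows "c \<odot>\<^bsub>\<A>\<^esub> cls u = cls (\<lambda>n. fscale c (u n))"
proof -
  have "congruent \<E> (\<lambda>u. cls (\<lambda>n. fscale c (u n)))"
  proof (rule congruentI)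
    fix u u' assume "(u, u') \<in> \<E>"
    then have C: "u \<in> \<C>" "u' \<in> \<C>" and *: "(\<lambda>n. q (u n - u' n)) \<longlonglongrightarrow> 0"
      by (auto simp: null_rel_def)
    have "q (fscale c (u n) - fscale c (u' n)) = cmod c * q (u n - u' n)" for n
      using C scale[of "u n - u' n" c] by (simp add: fscale_diff cauchy_mem free_star_on_closed)
    with C tendsto_mult_left[OF *, of "cmod c"]
    show "cls (\<lambda>n. fscale c (u n)) = cls (\<lambda>n. fscale c (u' n))"
      by (intro cls_eqI cauchy_closed) auto
  qed
  from UN_equiv_class[OF equiv_null this u] show ?thesis
    by (simp add: free_completion_def Let_def)
qed

lemma cadj_cls:
  assumes u: "u \<in> \<C>"
  shows "cadj \<A> (cls u) = cls (\<lambda>n. fadj (u n))"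
proof -
  have "congruent \<E> (\<lambda>u. cls (\<lambda>n. fadj (u n)))"
  proof (rule congruentI)
    fix u u' assume "(u, u') \<in> \<E>"
    then have C: "u \<in> \<C>" "u' \<in> \<C>" and *: "(\<lambda>n. q (u n - u' n)) \<longlonglongrightarrow> 0"
      by (auto simp: null_rel_def)
    have "q (fadj (u n) - fadj (u' n)) = q (u n - u' n)" for n
      using C adj[of "u n - u' n"] by (simp add: fadj_diff cauchy_mem free_star_on_closed)
    with C * show "cls (\<lambda>n. fadj (u n)) = cls (\<lambda>n. fadj (u' n))"
      by (intro cls_eqI cauchy_closed) auto
  qed
  from UN_equiv_class[OF equiv_null this u] show ?thesis
    by (simp add: free_completion_def Let_def)
qed

text \<open>The description by \<open>THE\<close> denotes something because the seminorms along a
  Cauchy sequence converge, and because by the reverse triangle inequality all representatives share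
  the limit.\<close>

lemma cnorm_cls:
  assumes u: "u \<in> \<C>"
  shows "(\<lambda>n. q (u n)) \<longlonglongrightarrow> cnorm \<A> (cls u)"
proof -
  obtain l where l: "(\<lambda>n. q (u n)) \<longlonglongrightarrow> l"
    using convergent_cauchy[OF u] by (auto simp: convergent_def)
  have v: "(\<lambda>n. q (v n)) \<longlonglongrightarrow> l" if "v \<in> cls u" for v
  proof -
    from that have C: "v \<in> \<C>" and *: "(\<lambda>n. q (u n - v n)) \<longlonglongrightarrow> 0"
      by (auto simp: null_rel_def)
    have "(\<lambda>n. q (u n) - q (v n)) \<longlonglongrightarrow> 0"
      using C u by (intro Lim_null_comparison[OF _ *] always_eventually)
        (auto intro: abs_diff_le cauchy_mem)
    from tendsto_diff[OF l this] show ?thesis by simp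
  qed
  have "cnorm \<A> (cls u) = (THE l. \<forall>v\<in>cls u. (\<lambda>n. q (v n)) \<longlonglongrightarrow> l)"
    by (simp add: free_completion_def Let_def)
  also have "\<dots> = l"
  proof (rule the_equality)
    fix l' assume "\<forall>v\<in>cls u. (\<lambda>n. q (v n)) \<longlonglongrightarrow> l'"
    then have "(\<lambda>n. q (u n)) \<longlonglongrightarrow> l'"
      using equiv_class_self[OF equiv_null u] by blast
    with l show "l' = l" by (rule LIMSEQ_unique[rotated])
  qed (use v in blast)
  finally show ?thesis using l by simp
qed

lemma cnorm_cls_eq: "\<lbrakk>u \<in> \<C>; (\<lambda>n. q (u n)) \<longlonglongrightarrow> l\<rbrakk> \<Longrightarrow> cnorm \<A> (cls u) = l"
  using cnorm_cls LIMSEQ_unique by blast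

lemma cnorm_cls_le:
  assumes "u \<in> \<C>" "\<And>n. n \<ge> K \<Longrightarrow> q (u n) \<le> B"
  shows "cnorm \<A> (cls u) \<le> B"
  using LIMSEQ_le_const2[OF cnorm_cls[OF assms(1)]] assms(2) by blast

lemmas cls_simps = add_cls mult_cls smult_cls cadj_cls one_cls zero_cls
  cauchy_closed cauchy_const cls_carrier

lemma ring_completion: "ring \<A>"
proof (rule ringI)
  show "abelian_group \<A>"
  proof (rule abelian_groupI)
    fix x assume "x \<in> carrier \<A>"
    then obtain u where u: "u \<in> \<C>" "x = cls u" by (rule carrierE)
    then show "\<exists>y\<in>carrier \<A>. y \<oplus>\<^bsub>\<A>\<^esub> x = \<zero>\<^bsub>\<A>\<^esub>"
      by (intro bexI[of _ "cls (\<lambda>n. - u n)"]) (simp_all add: cls_simps)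
  qed (auto elim!: carrierE simp: cls_simps add_ac)
  show "monoid \<A>"
    by (rule monoidI) (auto elim!: carrierE simp: cls_simps mult.assoc)
qed (auto elim!: carrierE simp: cls_simps distrib_left distrib_right)

lemma a_minus_cls:
  assumes "u \<in> \<C>" "v \<in> \<C>" shows "cls u \<ominus>\<^bsub>\<A>\<^esub> cls v = cls (\<lambda>n. u n - v n)"
proof -
  interpret ring \<A> by (rule ring_completion)
  have "\<ominus>\<^bsub>\<A>\<^esub> cls v = cls (\<lambda>n. - v n)"
    using assms by (intro minus_equality) (simp_all add: cls_simps)
  with assms show ?thesis
    by (simp add: a_minus_def cls_simps)
qed

text \<open>Diagonal argument: pick in a representative \<open>u m\<close> of the m-th class an
  index \<open>k m\<close> beyond which it varies by less than \<open>1 / real (Suc m)\<close>. The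
  chosen elements form a Cauchy sequence, and its class is the limit.\<close>

lemma completion_complete:
  assumes "range X \<subseteq> carrier \<A>"
    and X: "\<And>e. e > 0 \<Longrightarrow> \<exists>K. \<forall>m\<ge>K. \<forall>n\<ge>K. cnorm \<A> (X m \<ominus>\<^bsub>\<A>\<^esub> X n) < e"
  shows "\<exists>x\<in>carrier \<A>. (\<lambda>n. cnorm \<A> (X n \<ominus>\<^bsub>\<A>\<^esub> x)) \<longlonglongrightarrow> 0"
proof -
  have "\<forall>m. \<exists>u. u \<in> \<C> \<and> X m = cls u"
    using assms(1) carrier_iff by blast
  then obtain u where u: "\<And>m. u m \<in> \<C>" "\<And>m. X m = cls (u m)"
    by metis
  have mem: "u m i \<in> free_star_on G" for m i
    using u cauchy_mem by blast
  have "\<forall>m. \<exists>k. \<forall>i\<ge>k. \<forall>j\<ge>k. q (u m i - u m j) < 1 / real (Suc m)"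
    using cauchyD[OF u(1)] by simp
  then obtain k where k: "\<And>m i j. \<lbrakk>i \<ge> k m; j \<ge> k m\<rbrakk> \<Longrightarrow> q (u m i - u m j) < 1 / real (Suc m)"
    by metis
  define v where "v m = u m (k m)" for m
  have v_mem: "v m \<in> free_star_on G" for m
    by (simp add: v_def mem)
  have small: "\<exists>K. \<forall>n\<ge>K. 1 / real (Suc n) < e" if "e > 0" for e :: real
    using order_tendstoD(2)[OF LIMSEQ_inverse_real_of_nat that]
    by (auto simp: eventually_sequentially inverse_eq_divide)
  have v: "v \<in> \<C>"
  proof (rule cauchyI)
    fix e :: real assume "e > 0"
    then obtain K where K: "\<forall>m\<ge>K. \<forall>n\<ge>K. cnorm \<A> (X m \<ominus>\<^bsub>\<A>\<^esub> X n) < e/3" using X[of "e/3"] by auto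
    obtain L where L: "\<forall>n\<ge>L. 1 / real (Suc n) < e/3" using small[of "e/3"] \<open>e > 0\<close> by auto
    have "q (v m - v n) < e" if mn: "m \<ge> max K L" "n \<ge> max K L" for m n
    proof -
      have "cnorm \<A> (cls (\<lambda>i. u m i - u n i)) < e/3"
        using K mn u by (simp flip: a_minus_cls)
      with cnorm_cls[of "\<lambda>i. u m i - u n i"] u
      have "\<forall>\<^sub>F i in sequentially. q (u m i - u n i) < e/3"
        by (intro order_tendstoD(2)[rotated]) (auto intro: cauchy_closed)
      then obtain J where J: "\<And>i. i \<ge> J \<Longrightarrow> q (u m i - u n i) < e/3"
        by (auto simp: eventually_sequentially)
      \<comment> \<open>An auxiliary index past all three thresholds. It links \<open>v m\<close> to
        \<open>v n\<close> through \<open>u m i\<close> and \<open>u n i\<close>, each step costing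
        less than \<open>e/3\<close>.\<close>
      define i where "i = max J (max (k m) (k n))"
      have "q (v m - v n) \<le> q (v m - u m i) + (q (u m i - u n i) + q (u n i - v n))"
        using triangle_diff[of "v m" "u m i" "v n"] triangle_diff[of "u m i" "u n i" "v n"] mem v_mem by force
      moreover have "q (v m - u m i) < e/3"
        unfolding v_def using k[of m "k m" i] L mn by (fastforce simp: i_def)
      moreover have "q (u n i - v n) < e/3"
        unfolding v_def using k[of n i "k n"] L mn by (fastforce simp: i_def)
      moreover have "q (u m i - u n i) < e/3" using J by (simp add: i_def)
      ultimately show ?thesis by simp
    qed
    then show "\<exists>K. \<forall>m\<ge>K. \<forall>n\<ge>K. q (v m - v n) < e" by blast
  qed (rule v_mem)
  have "(\<lambda>n. cnorm \<A> (X n \<ominus>\<^bsub>\<A>\<^esub> cls v)) \<longlonglongrightarrow> 0"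
  proof (rule LIMSEQ_I)
    fix e :: real assume "e > 0"
    then obtain K where K: "\<forall>m\<ge>K. \<forall>n\<ge>K. q (v m - v n) < e/3" using cauchyD[OF v, of "e/3"] by auto
    obtain L where L: "\<forall>n\<ge>L. 1 / real (Suc n) < e/3" using small[of "e/3"] \<open>e > 0\<close> by auto
    have "norm (cnorm \<A> (X n \<ominus>\<^bsub>\<A>\<^esub> cls v) - 0) < e" if n: "n \<ge> max K L" for n
    proof -
      have C: "(\<lambda>i. u n i - v i) \<in> \<C>" using u v by (intro cauchy_closed)
      \<comment> \<open>Strict bounds become weak in the limit, so the bound is kept at two thirds
        of \<open>e\<close>.\<close>
      have "q (u n i - v i) \<le> 2 * e / 3" if i: "i \<ge> max n (k n)" for i
      proof -
        have "q (u n i - v i) \<le> q (u n i - v n) + q (v n - v i)"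
          using mem v_mem by (intro triangle_diff)
        moreover have "q (u n i - v n) < e/3"
          unfolding v_def using k[of n i "k n"] L n i by fastforce
        moreover have "q (v n - v i) < e/3" using K n i by auto
        ultimately show ?thesis by simp
      qed
      with C have "cnorm \<A> (cls (\<lambda>i. u n i - v i)) \<le> 2 * e / 3"
        by (intro cnorm_cls_le)
      moreover have "0 \<le> cnorm \<A> (cls (\<lambda>i. u n i - v i))"
        using cnorm_cls[OF C] by (rule LIMSEQ_le_const) (use C nonneg cauchy_mem in blast)
      ultimately show ?thesis
        using u v \<open>e > 0\<close> by (simp add: a_minus_cls)
    qed
    then show "\<exists>K. \<forall>n\<ge>K. norm (cnorm \<A> (X n \<ominus>\<^bsub>\<A>\<^esub> cls v) - 0) < e" by blast
  qed
  with v show ?thesis using cls_carrier by blast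
qed

lemma cstar_algebra_completion: "cstar_algebra \<A>"
proof -
  interpret ring \<A> by (rule ring_completion)
  show ?thesis
  proof
    fix x assume "x \<in> carrier \<A>"
    then obtain u where u: "u \<in> \<C>" "x = cls u" by (rule carrierE)
    have mem: "u n \<in> free_star_on G" for n using u cauchy_mem by blast
    note lim = cnorm_cls[OF u(1)]
    show "0 \<le> cnorm \<A> x"
      using lim mem unfolding u(2) by (intro LIMSEQ_le_const[OF lim]) (auto intro: nonneg)
    show "cnorm \<A> x = 0 \<longleftrightarrow> x = \<zero>\<^bsub>\<A>\<^esub>"
    proof
      assume "cnorm \<A> x = 0"
      then show "x = \<zero>\<^bsub>\<A>\<^esub>"
        using lim u unfolding zero_cls u(2) by (intro cls_eqI) (auto simp: cauchy_const)
    next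
      assume "x = \<zero>\<^bsub>\<A>\<^esub>"
      then show "cnorm \<A> x = 0"
        by (simp add: zero_cls cnorm_cls_eq cauchy_const)
    qed
    show "cnorm \<A> (cadj \<A> x \<otimes>\<^bsub>\<A>\<^esub> x) = (cnorm \<A> x)\<^sup>2"
      using tendsto_power[OF lim, of 2] u mem by (simp add: cls_simps cnorm_cls_eq cstar)
    show "cnorm \<A> (c \<odot>\<^bsub>\<A>\<^esub> x) = cmod c * cnorm \<A> x" for c
      using tendsto_mult_left[OF lim, of "cmod c"] u mem by (simp add: cls_simps cnorm_cls_eq scale)
    fix y assume "y \<in> carrier \<A>"
    then obtain v where v: "v \<in> \<C>" "y = cls v" by (rule carrierE)
    have mem': "v n \<in> free_star_on G" for n using v cauchy_mem by blast
    note lim' = cnorm_cls[OF v(1)]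
    show "cnorm \<A> (x \<oplus>\<^bsub>\<A>\<^esub> y) \<le> cnorm \<A> x + cnorm \<A> y"
      using LIMSEQ_le[OF cnorm_cls[OF cauchy_add[OF u(1) v(1)]] tendsto_add[OF lim lim']] u v mem mem'
      by (auto simp: cls_simps triangle)
    show "cnorm \<A> (x \<otimes>\<^bsub>\<A>\<^esub> y) \<le> cnorm \<A> x * cnorm \<A> y"
      using LIMSEQ_le[OF cnorm_cls[OF cauchy_mult[OF u(1) v(1)]] tendsto_mult[OF lim lim']] u v mem mem'
      by (auto simp: cls_simps submult)
  next
    fix X :: "nat \<Rightarrow> (nat \<Rightarrow> 'g free_star) set"
    assume "range X \<subseteq> carrier \<A>" "\<And>e. e > 0 \<Longrightarrow> \<exists>K. \<forall>m\<ge>K. \<forall>n\<ge>K. cnorm \<A> (X m \<ominus>\<^bsub>\<A>\<^esub> X n) < e"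
    then show "\<exists>x\<in>carrier \<A>. (\<lambda>n. cnorm \<A> (X n \<ominus>\<^bsub>\<A>\<^esub> x)) \<longlonglongrightarrow> 0"
      by (rule completion_complete)
  qed (auto elim!: carrierE simp: cls_simps fscale_add fscale_add_left fscale_fscale
    fscale_mult_left fscale_mult_right fadj_add fadj_fscale fadj_mult)
qed

end

section \<open>Universal C*-seminorms and crossed products\<close>

lemma cstar_seminorm_iff:
  "cstar_seminorm G R q \<longleftrightarrow> free_star_seminorm G q \<and> (\<forall>x\<in>R. q x = 0)"
  unfolding cstar_seminorm_def free_star_seminorm_def by blast

text \<open>Keeps the set under the supremum nonempty and bounds the universal seminorm below by
  0.\<close>

lemma cstar_seminorm_zero: "cstar_seminorm G R (\<lambda>_. 0)"
  by (simp add: cstar_seminorm_def)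

lemma (in free_star_seminorm) one_le: "q 1 \<le> 1"
proof -
  have "q 1 = (q 1)\<^sup>2" using cstar[of 1] by simp
  then have "q 1 = 0 \<or> q 1 = 1" by (simp add: power2_eq_square)
  then show ?thesis by auto
qed

lemma (in free_star_seminorm) eq_of_diff_zero:
  assumes "q (x - y) = 0" "x \<in> free_star_on G" "y \<in> free_star_on G"
  shows "q x = q y"
  using abs_diff_le[of x y] assms by simp

text \<open>Inequalities pass to a finite pointwise supremum. The two equalities, homogeneity and
  the C*-identity, are each split into two inequalities.\<close>

lemma cstar_seminorm_universal:
  assumes bdd: "\<And>x. x \<in> free_star_on G \<Longrightarrow> bdd_above {q x |q. cstar_seminorm G R q}"
  shows "cstar_seminorm G R (universal_seminorm G R)"
proof -
  let ?U = "universal_seminorm G R"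
  have upper: "q x \<le> ?U x" if "cstar_seminorm G R q" "x \<in> free_star_on G" for q x
    unfolding universal_seminorm_def using that by (intro cSup_upper bdd) auto
  have least: "?U x \<le> B" if "\<And>q. \<lbrakk>cstar_seminorm G R q; free_star_seminorm G q\<rbrakk> \<Longrightarrow> q x \<le> B" for x B
    unfolding universal_seminorm_def
  proof (rule cSup_least)
    show "{q x |q. cstar_seminorm G R q} \<noteq> {}"
      using cstar_seminorm_zero by blast
  qed (use that cstar_seminorm_iff in blast)
  have nonneg: "0 \<le> ?U x" if "x \<in> free_star_on G" for x
    using upper[OF cstar_seminorm_zero that] .
  have scale_le: "?U (fscale c x) \<le> cmod c * ?U x" if "x \<in> free_star_on G" for c x
    using that by (intro least) (simp add: free_star_seminorm.scale mult_left_mono upper)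
  have "free_star_seminorm G ?U"
  proof
    fix x assume x: "x \<in> free_star_on G"
    show "0 \<le> ?U x" by (rule nonneg[OF x])
    show "?U (fscale c x) = cmod c * ?U x" for c
    proof (cases "c = 0")
      case True
      then show ?thesis using scale_le[OF x, of c] nonneg[of 0] by simp
    next
      case False
      \<comment> \<open>The reverse inequality is \<open>scale_le\<close> with factor
        \<open>1 / c\<close>, applied to the scaled element.\<close>
      have "cmod c * ?U x = cmod c * ?U (fscale (1 / c) (fscale c x))"
        using False by (simp add: fscale_fscale)
      also have "\<dots> \<le> cmod c * (cmod (1 / c) * ?U (fscale c x))"
        using x by (intro mult_left_mono scale_le free_star_on_closed) auto
      also have "\<dots> = ?U (fscale c x)"
        using False by (simp add: norm_divide)
      finally show ?thesis using scale_le[OF x, of c] by simp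
    qed
    show "?U (fadj x * x) = (?U x)\<^sup>2"
    proof (rule antisym)
      show "?U (fadj x * x) \<le> (?U x)\<^sup>2"
        using x by (intro least) (simp add: free_star_seminorm.cstar free_star_seminorm.nonneg power_mono upper)
      \<comment> \<open>Taking the root first bounds every \<open>q x\<close> by one number
        independent of \<open>q\<close>, which is what a supremum can be compared with.\<close>
      have "?U x \<le> sqrt (?U (fadj x * x))"
      proof (rule least)
        fix q assume q: "cstar_seminorm G R q" "free_star_seminorm G q"
        have "q x = sqrt (q (fadj x * x))"
          using q x by (simp add: free_star_seminorm.cstar free_star_seminorm.nonneg)
        also have "\<dots> \<le> sqrt (?U (fadj x * x))"
          using q x by (intro real_sqrt_le_mono upper free_star_on_closed)
        finally show "q x \<le> sqrt (?U (fadj x * x))" .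
      qed
      then have "(?U x)\<^sup>2 \<le> (sqrt (?U (fadj x * x)))\<^sup>2"
        using nonneg[OF x] by (intro power_mono)
      also have "\<dots> = ?U (fadj x * x)"
        using x by (simp add: nonneg free_star_on_closed)
      finally show "(?U x)\<^sup>2 \<le> ?U (fadj x * x)" .
    qed
    fix y assume y: "y \<in> free_star_on G"
    show "?U (x + y) \<le> ?U x + ?U y"
    proof (rule least)
      fix q assume q: "cstar_seminorm G R q" "free_star_seminorm G q"
      show "q (x + y) \<le> ?U x + ?U y"
        using free_star_seminorm.triangle[OF q(2) x y] upper[OF q(1) x] upper[OF q(1) y] by linarith
    qed
    show "?U (x * y) \<le> ?U x * ?U y"
    proof (rule least)
      fix q assume q: "cstar_seminorm G R q" "free_star_seminorm G q"
      have "q (x * y) \<le> q x * q y"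
        by (rule free_star_seminorm.submult[OF q(2) x y])
      also have "\<dots> \<le> ?U x * ?U y"
        using q x y by (intro mult_mono upper nonneg free_star_seminorm.nonneg)
      finally show "q (x * y) \<le> ?U x * ?U y" .
    qed
  qed
  moreover have "?U x = 0" if "x \<in> R" for x
  proof -
    have "{q x |q. cstar_seminorm G R q} = {0}"
      using that cstar_seminorm_zero[of G R] by (auto simp: cstar_seminorm_iff)
    then show ?thesis by (simp add: universal_seminorm_def)
  qed
  ultimately show ?thesis by (simp add: cstar_seminorm_iff)
qed

text \<open>Adjoints have equal seminorm, so a word is bounded by the product of the bounds of its
  letters, and a linear combination by the triangle inequality. The bound may depend on the element
  but never on \<open>q\<close>.\<close>

lemma cstar_seminorms_bdd_above:
  assumes gen: "\<And>g. g \<in> G \<Longrightarrow> \<exists>B. \<forall>q. cstar_seminorm G R q \<longrightarrow> q (fgen g) \<le> B"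
    and x: "x \<in> free_star_on G"
  shows "bdd_above {q x |q. cstar_seminorm G R q}"
proof -
  have word: "\<exists>B. \<forall>q. cstar_seminorm G R q \<longrightarrow> q (Poly_Mapping.single (Word l) 1) \<le> B"
    if "fst ` set l \<subseteq> G" for l
    using that
  proof (induction l)
    case Nil
    have "Poly_Mapping.single (Word []) 1 = (1 :: 'a free_star)"
      by (metis single_one zero_star_word_def)
    then show ?case
      using free_star_seminorm.one_le by (auto simp: cstar_seminorm_iff intro!: exI[of _ 1])
  next
    case (Cons a l)
    obtain g b where a: "a = (g, b)" by fastforce
    with Cons obtain B D where B: "\<And>q. cstar_seminorm G R q \<Longrightarrow> q (Poly_Mapping.single (Word l) 1) \<le> B"
      and D: "\<And>q. cstar_seminorm G R q \<Longrightarrow> q (fgen g) \<le> D"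
      using gen[of g] by fastforce
    define y where "y = (if b then fadj (fgen g) else fgen g)"
    have g: "fgen g \<in> free_star_on G" and l: "Poly_Mapping.single (Word l) 1 \<in> free_star_on G"
      using Cons.prems by (simp_all add: a free_star_on_fgen free_star_on_single)
    have eq: "Poly_Mapping.single (Word (a # l)) 1 = y * Poly_Mapping.single (Word l) 1"
      by (simp add: y_def a fgen_def fadj_single mult_single plus_star_word_def word_adj_def)
    have "q (Poly_Mapping.single (Word (a # l)) 1) \<le> D * B" if q: "cstar_seminorm G R q" for q
    proof -
      interpret free_star_seminorm G q using q by (simp add: cstar_seminorm_iff)
      have y: "y \<in> free_star_on G" "q y = q (fgen g)"
        using g adj[of "fgen g"] by (simp_all add: y_def free_star_on_closed)
      have "q (y * Poly_Mapping.single (Word l) 1) \<le> q y * q (Poly_Mapping.single (Word l) 1)"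
        using y l by (intro submult)
      also have "\<dots> \<le> D * B"
        using B[OF q] D[OF q] nonneg[OF g] nonneg[OF l] y by (intro mult_mono) auto
      finally show ?thesis by (simp add: eq)
    qed
    then show ?case by blast
  qed
  \<comment> \<open>Membership is carried through the induction because the triangle inequality asks
    for it at the partial sum \<open>y\<close>.\<close>
  have "x \<in> free_star_on G \<and> (\<exists>B. \<forall>q. cstar_seminorm G R q \<longrightarrow> q x \<le> B)"
    using x[unfolded free_star_on_keys]
  proof (induction rule: poly_mapping_single_induct)
    case zero
    show ?case by (auto simp: cstar_seminorm_iff free_star_seminorm.zero intro!: exI[of _ 0])
  next
    case (add w c y)
    then obtain B where B: "\<And>q. cstar_seminorm G R q \<Longrightarrow> q y \<le> B" by blast
    obtain D where D: "\<And>q. cstar_seminorm G R q \<Longrightarrow> q (Poly_Mapping.single w 1) \<le> D"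
      using word[of "letters w"] add by auto
    have w: "Poly_Mapping.single w c \<in> free_star_on G" for c
      using add by (auto intro: free_star_on_single)
    have "q (Poly_Mapping.single w c + y) \<le> cmod c * D + B" if q: "cstar_seminorm G R q" for q
    proof -
      interpret free_star_seminorm G q using q by (simp add: cstar_seminorm_iff)
      have "q (Poly_Mapping.single w c) = cmod c * q (Poly_Mapping.single w 1)"
        using scale[OF w, of c 1] by (simp add: fscale_single)
      moreover have "q (Poly_Mapping.single w c + y) \<le> q (Poly_Mapping.single w c) + q y"
        using w add by (intro triangle) auto
      ultimately show ?thesis
        using B[OF q] mult_left_mono[OF D[OF q], of "cmod c"] by simp
    qed
    then have "\<exists>B. \<forall>q. cstar_seminorm G R q \<longrightarrow> q (Poly_Mapping.single w c + y) \<le> B"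
      by (intro exI allI impI)
    moreover have "Poly_Mapping.single w c + y \<in> free_star_on G"
      using add.IH w by (intro free_star_on_add) simp_all
    ultimately show ?case by (rule conjI[rotated])
  qed
  then show ?thesis by (auto simp: bdd_above_def)
qed

text \<open>\<open>relabel \<sigma>\<close> is a *-homomorphism, so composing with it preserves
  every axiom of a C*-seminorm; \<open>R\<close> is annihilated because it is sent into
  \<open>S\<close>.\<close>

lemma cstar_seminorm_relabel:
  assumes "\<sigma> ` G \<subseteq> H" "relabel \<sigma> ` R \<subseteq> S" "cstar_seminorm H S q"
  shows "cstar_seminorm G R (\<lambda>x. q (relabel \<sigma> x))"
proof -
  interpret free_star_seminorm H q using assms(3) by (simp add: cstar_seminorm_iff)
  note [simp] = free_star_on_relabel[OF assms(1)]
  have "free_star_seminorm G (\<lambda>x. q (relabel \<sigma> x))"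
    by standard (simp_all add: nonneg triangle scale submult cstar
      relabel_add relabel_mult relabel_fscale relabel_fadj)
  with assms show ?thesis by (auto simp: cstar_seminorm_iff)
qed

text \<open>Pulling seminorms back along \<open>\<sigma>\<close> and along \<open>\<tau>\<close>
  shows that both suprema are taken over the same set of real numbers.\<close>

lemma universal_seminorm_relabel:
  assumes \<sigma>: "\<sigma> ` G \<subseteq> H" "relabel \<sigma> ` R \<subseteq> S"
    and \<tau>: "\<tau> ` H \<subseteq> G" "relabel \<tau> ` S \<subseteq> R"
    and inv: "\<And>g. g \<in> G \<Longrightarrow> \<tau> (\<sigma> g) = g"
    and x: "x \<in> free_star_on G"
  shows "universal_seminorm H S (relabel \<sigma> x) = universal_seminorm G R x"
proof -
  have "{q (relabel \<sigma> x) |q. cstar_seminorm H S q} = {q x |q. cstar_seminorm G R q}"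
  proof (intro equalityI subsetI)
    fix t assume "t \<in> {q x |q. cstar_seminorm G R q}"
    then obtain q where q: "t = q x" "cstar_seminorm G R q" by blast
    have "relabel \<tau> (relabel \<sigma> x) = x" using inv x by (rule relabel_inverse)
    then show "t \<in> {q (relabel \<sigma> x) |q. cstar_seminorm H S q}"
      using cstar_seminorm_relabel[OF \<tau> q(2)] q(1)
      by (intro CollectI exI[of _ "\<lambda>x. q (relabel \<tau> x)"]) simp
  next
    fix t assume "t \<in> {q (relabel \<sigma> x) |q. cstar_seminorm H S q}"
    then obtain q where q: "t = q (relabel \<sigma> x)" "cstar_seminorm H S q" by blast
    then show "t \<in> {q x |q. cstar_seminorm G R q}"
      using cstar_seminorm_relabel[OF \<sigma> q(2)]
      by (intro CollectI exI[of _ "\<lambda>x. q (relabel \<sigma> x)"]) simp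
  qed
  then show ?thesis by (simp add: universal_seminorm_def)
qed

text \<open>The relabelling acts termwise on Cauchy sequences. Injectivity on classes comes from the
  isometry; surjectivity from relabelling a representative back by \<open>\<tau>\<close>.\<close>

lemma free_completion_isomorphic:
  assumes p: "free_star_seminorm G p" and q: "free_star_seminorm H q"
    and \<sigma>: "\<sigma> ` G \<subseteq> H" and \<tau>: "\<tau> ` H \<subseteq> G" and inv: "\<And>h. h \<in> H \<Longrightarrow> \<sigma> (\<tau> h) = h"
    and isometry: "\<And>x. x \<in> free_star_on G \<Longrightarrow> q (relabel \<sigma> x) = p x"
  shows "free_completion G p \<cong>\<^sub>C free_completion H q"
proof -
  interpret P: free_star_seminorm G p by (rule p)
  interpret Q: free_star_seminorm H q by (rule q)
  let ?\<Phi> = "\<lambda>u n. relabel \<sigma> (u n)"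
  define h where "h X = (\<Union>u\<in>X. Q.cls (?\<Phi> u))" for X
  have dist: "q (relabel \<sigma> x - relabel \<sigma> y) = p (x - y)" if "x \<in> free_star_on G" "y \<in> free_star_on G" for x y
    using isometry[of "x - y"] that by (simp add: relabel_diff free_star_on_closed)
  have cauchy: "?\<Phi> u \<in> Q.\<C>" if u: "u \<in> P.\<C>" for u
  proof (rule Q.cauchyI)
    show "relabel \<sigma> (u n) \<in> free_star_on H" for n
      using \<sigma> P.cauchy_mem[OF u] by (rule free_star_on_relabel)
    fix e :: real assume "e > 0"
    with P.cauchyD[OF u] P.cauchy_mem[OF u]
    show "\<exists>K. \<forall>m\<ge>K. \<forall>n\<ge>K. q (relabel \<sigma> (u m) - relabel \<sigma> (u n)) < e"
      by (simp add: dist)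
  qed
  have h_cls: "h (P.cls u) = Q.cls (?\<Phi> u)" if u: "u \<in> P.\<C>" for u
    unfolding h_def
  proof (rule UN_equiv_class[OF P.equiv_null _ u], rule congruentI)
    fix v w assume "(v, w) \<in> P.\<E>"
    then have "v \<in> P.\<C>" "w \<in> P.\<C>" "(\<lambda>n. p (v n - w n)) \<longlonglongrightarrow> 0"
      by (auto simp: null_rel_def)
    then show "Q.cls (?\<Phi> v) = Q.cls (?\<Phi> w)"
      by (intro Q.cls_eqI cauchy) (simp_all add: dist P.cauchy_mem)
  qed
  have "h \<in> star_hom P.\<A> Q.\<A>"
    unfolding star_hom_def ring_hom_def
    by (auto elim!: P.carrierE simp: P.cls_simps Q.cls_simps h_cls cauchy
      relabel_add relabel_mult relabel_fscale relabel_fadj)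
  moreover have "bij_betw h (carrier P.\<A>) (carrier Q.\<A>)"
    unfolding bij_betw_def
  proof
    show "inj_on h (carrier P.\<A>)"
    proof (rule inj_onI)
      fix X Y assume "X \<in> carrier P.\<A>" "Y \<in> carrier P.\<A>" and eq: "h X = h Y"
      then obtain u v where u: "u \<in> P.\<C>" "X = P.cls u" and v: "v \<in> P.\<C>" "Y = P.cls v"
        by (metis P.carrierE)
      with eq have "(?\<Phi> u, ?\<Phi> v) \<in> Q.\<E>"
        by (simp add: h_cls eq_equiv_class_iff[OF Q.equiv_null cauchy cauchy])
      then have "(\<lambda>n. p (u n - v n)) \<longlonglongrightarrow> 0"
        using u v by (simp add: null_rel_def dist P.cauchy_mem)
      with u(1) v(1) show "X = Y" unfolding u(2) v(2) by (rule P.cls_eqI)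
    qed
    show "h ` carrier P.\<A> = carrier Q.\<A>"
    proof (intro equalityI subsetI)
      fix Y assume "Y \<in> carrier Q.\<A>"
      then obtain v where v: "v \<in> Q.\<C>" "Y = Q.cls v" by (rule Q.carrierE)
      define u where "u n = relabel \<tau> (v n)" for n
      have u_mem: "u n \<in> free_star_on G" for n
        unfolding u_def using \<tau> Q.cauchy_mem[OF v(1)] by (rule free_star_on_relabel)
      have \<Phi>u: "relabel \<sigma> (u n) = v n" for n
        unfolding u_def using inv Q.cauchy_mem[OF v(1)] by (rule relabel_inverse)
      have "u \<in> P.\<C>"
      proof (rule P.cauchyI[OF u_mem])
        fix e :: real assume "e > 0"
        from Q.cauchyD[OF v(1) this]
        show "\<exists>K. \<forall>m\<ge>K. \<forall>n\<ge>K. p (u m - u n) < e"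
          by (simp add: u_mem \<Phi>u flip: dist)
      qed
      with v show "Y \<in> h ` carrier P.\<A>"
        by (intro image_eqI[of _ _ "P.cls u"]) (simp_all add: h_cls \<Phi>u P.cls_carrier)
    qed (auto elim!: P.carrierE simp: h_cls intro!: Q.cls_carrier cauchy)
  qed
  ultimately show ?thesis
    unfolding cstar_isomorphic_def
    using P.cstar_algebra_completion Q.cstar_algebra_completion by blast
qed

section \<open>Functoriality of the crossed product\<close>

lemma cp_rels_intros:
  "\<lbrakk>f \<in> carrier C; g \<in> carrier C\<rbrakk> \<Longrightarrow> fgen (M (f \<oplus>\<^bsub>C\<^esub> g)) - (fgen (M f) + fgen (M g)) \<in> cp_rels C \<alpha>"
  "\<lbrakk>f \<in> carrier C; g \<in> carrier C\<rbrakk> \<Longrightarrow> fgen (M (f \<otimes>\<^bsub>C\<^esub> g)) - fgen (M f) * fgen (M g) \<in> cp_rels C \<alpha>"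
  "f \<in> carrier C \<Longrightarrow> fgen (M (c \<odot>\<^bsub>C\<^esub> f)) - fscale c (fgen (M f)) \<in> cp_rels C \<alpha>"
  "f \<in> carrier C \<Longrightarrow> fgen (M (cadj C f)) - fadj (fgen (M f)) \<in> cp_rels C \<alpha>"
  "fgen (M \<one>\<^bsub>C\<^esub>) - 1 \<in> cp_rels C \<alpha>"
  "fadj (fgen V) * fgen V - 1 \<in> cp_rels C \<alpha>"
  "f \<in> carrier C \<Longrightarrow> fgen V * fgen (M f) * fadj (fgen V) - fgen (M (\<alpha> f)) \<in> cp_rels C \<alpha>"
  unfolding cp_rels_def
  subgoal by (rule UnI1, rule UnI1, rule UnI1, rule UnI1, rule UnI1, rule UnI1, blast)
  subgoal by (rule UnI1, rule UnI1, rule UnI1, rule UnI1, rule UnI1, rule UnI2, blast)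
  subgoal by (rule UnI1, rule UnI1, rule UnI1, rule UnI1, rule UnI2, blast)
  subgoal by (rule UnI1, rule UnI1, rule UnI1, rule UnI2, blast)
  subgoal by (rule UnI1, rule UnI1, rule UnI2, rule singletonI)
  subgoal by (rule UnI1, rule UnI2, rule singletonI)
  subgoal by (rule UnI2, blast)
  done

text \<open>There is a clause for each family of relations except \<open>V* V = 1\<close>, which is
  preserved because \<open>V\<close> is sent to \<open>V\<close>.\<close>

locale cp_morphism =
  fixes C :: "('f, 'm) cstar_scheme" and D :: "('h, 'n) cstar_scheme"
    and \<alpha> :: "'f \<Rightarrow> 'f" and \<beta> :: "'h \<Rightarrow> 'h" and \<phi> :: "'f \<Rightarrow> 'h"
  assumes closed: "f \<in> carrier C \<Longrightarrow> \<phi> f \<in> carrier D"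
    and add: "\<lbrakk>f \<in> carrier C; g \<in> carrier C\<rbrakk> \<Longrightarrow> \<phi> (f \<oplus>\<^bsub>C\<^esub> g) = \<phi> f \<oplus>\<^bsub>D\<^esub> \<phi> g"
    and mult: "\<lbrakk>f \<in> carrier C; g \<in> carrier C\<rbrakk> \<Longrightarrow> \<phi> (f \<otimes>\<^bsub>C\<^esub> g) = \<phi> f \<otimes>\<^bsub>D\<^esub> \<phi> g"
    and smult: "f \<in> carrier C \<Longrightarrow> \<phi> (c \<odot>\<^bsub>C\<^esub> f) = c \<odot>\<^bsub>D\<^esub> \<phi> f"
    and cadj: "f \<in> carrier C \<Longrightarrow> \<phi> (cadj C f) = cadj D (\<phi> f)"
    and one: "\<phi> \<one>\<^bsub>C\<^esub> = \<one>\<^bsub>D\<^esub>"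
    and intertwines: "f \<in> carrier C \<Longrightarrow> \<phi> (\<alpha> f) = \<beta> (\<phi> f)"
begin

lemma map_gens: "map_cp_gen \<phi> ` cp_gens C \<subseteq> cp_gens D"
  by (auto simp: cp_gens_def closed)

lemma relabel_rels: "relabel (map_cp_gen \<phi>) ` cp_rels C \<alpha> \<subseteq> cp_rels D \<beta>"
proof (rule image_subsetI)
  fix x assume "x \<in> cp_rels C \<alpha>"
  then show "relabel (map_cp_gen \<phi>) x \<in> cp_rels D \<beta>"
    unfolding cp_rels_def[of C]
    by (elim UnE CollectE exE conjE singletonE)
      (simp_all add: relabel_add relabel_mult relabel_diff relabel_fscale relabel_fadj relabel_fgen
        add mult smult cadj one intertwines closed cp_rels_intros)
qed

end

text \<open>Inverse morphisms exchange generators and relations, which equates the universal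
  seminorms. The bounds \<open>bdd\<close> serve to make these seminorms C*-seminorms, so that the
  completions are C*-algebras.\<close>

lemma crossed_product_isomorphic:
  assumes \<phi>: "cp_morphism C D \<alpha> \<beta> \<phi>" and \<psi>: "cp_morphism D C \<beta> \<alpha> \<psi>"
    and inv: "\<And>f. f \<in> carrier C \<Longrightarrow> \<psi> (\<phi> f) = f" "\<And>f. f \<in> carrier D \<Longrightarrow> \<phi> (\<psi> f) = f"
    and bdd: "\<And>x. x \<in> free_star_on (cp_gens C) \<Longrightarrow> bdd_above {q x |q. cstar_seminorm (cp_gens C) (cp_rels C \<alpha>) q}"
      "\<And>x. x \<in> free_star_on (cp_gens D) \<Longrightarrow> bdd_above {q x |q. cstar_seminorm (cp_gens D) (cp_rels D \<beta>) q}"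
  shows "crossed_product C \<alpha> \<cong>\<^sub>C crossed_product D \<beta>"
  unfolding crossed_product_def universal_cstar_def
proof (rule free_completion_isomorphic)
  note \<phi>' = cp_morphism.map_gens[OF \<phi>] cp_morphism.relabel_rels[OF \<phi>]
  note \<psi>' = cp_morphism.map_gens[OF \<psi>] cp_morphism.relabel_rels[OF \<psi>]
  show "free_star_seminorm (cp_gens C) (universal_seminorm (cp_gens C) (cp_rels C \<alpha>))"
    "free_star_seminorm (cp_gens D) (universal_seminorm (cp_gens D) (cp_rels D \<beta>))"
    using cstar_seminorm_universal[OF bdd(1)] cstar_seminorm_universal[OF bdd(2)]
    by (simp_all only: cstar_seminorm_iff)
  show "map_cp_gen \<phi> ` cp_gens C \<subseteq> cp_gens D" by (rule \<phi>')
  show "map_cp_gen \<psi> ` cp_gens D \<subseteq> cp_gens C" by (rule \<psi>')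
  show "map_cp_gen \<phi> (map_cp_gen \<psi> g) = g" if "g \<in> cp_gens D" for g
    using that by (auto simp: cp_gens_def inv)
  have "map_cp_gen \<psi> (map_cp_gen \<phi> g) = g" if "g \<in> cp_gens C" for g
    using that by (auto simp: cp_gens_def inv)
  then show "universal_seminorm (cp_gens D) (cp_rels D \<beta>) (relabel (map_cp_gen \<phi>) x)
      = universal_seminorm (cp_gens C) (cp_rels C \<alpha>) x" if "x \<in> free_star_on (cp_gens C)" for x
    using that by (intro universal_seminorm_relabel[OF \<phi>' \<psi>'])
qed

section \<open>Crossed products of \<open>C(X)\<close>\<close>

text \<open>An arbitrary seminorm is fixed, so the constants \<open>1\<close> and
  \<open>2 * K\<close> obtained below hold for all of them at once.\<close>

locale cfun_cp_seminorm =
  fixes X :: "'x::topological_space set" and \<alpha> q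
  assumes seminorm: "cstar_seminorm (cp_gens (cfun X)) (cp_rels (cfun X) \<alpha>) q"

sublocale cfun_cp_seminorm \<subseteq> free_star_seminorm "cp_gens (cfun X)" q
  using seminorm by (simp add: cstar_seminorm_iff)

context cfun_cp_seminorm
begin

lemma rel_zero: "x \<in> cp_rels (cfun X) \<alpha> \<Longrightarrow> q x = 0"
  using seminorm by (simp add: cstar_seminorm_iff)

lemma M_mem: "f \<in> carrier (cfun X) \<Longrightarrow> fgen (M f) \<in> free_star_on (cp_gens (cfun X))"
  by (simp add: free_star_on_fgen cp_gens_def)

lemma V_mem: "fgen V \<in> free_star_on (cp_gens (cfun X))"
  by (simp add: free_star_on_fgen cp_gens_def)

lemma add_closed:
  "\<lbrakk>f \<in> carrier (cfun X); g \<in> carrier (cfun X)\<rbrakk> \<Longrightarrow> (\<lambda>x. f x + g x) \<in> carrier (cfun X)"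
  by (auto simp: cfun_def intro: continuous_intros)

lemma smult_closed: "f \<in> carrier (cfun X) \<Longrightarrow> (\<lambda>x. c * f x) \<in> carrier (cfun X)"
  by (auto simp: cfun_def intro: continuous_intros)

text \<open>The generators \<open>M f\<close> are formal symbols, and \<open>f \<mapsto> M f\<close>
  is additive only modulo the relations. \<open>q\<close> annihilates the defect and therefore does
  not distinguish the two sides.\<close>

lemma q_M_add:
  assumes "f \<in> carrier (cfun X)" "g \<in> carrier (cfun X)"
  shows "q (fgen (M (\<lambda>x. f x + g x))) \<le> q (fgen (M f)) + q (fgen (M g))"
proof -
  have "q (fgen (M (\<lambda>x. f x + g x)) - (fgen (M f) + fgen (M g))) = 0"
    using rel_zero[OF cp_rels_intros(1)[OF assms]] by (simp add: cfun_def)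
  then have "q (fgen (M (\<lambda>x. f x + g x))) = q (fgen (M f) + fgen (M g))"
    using assms by (intro eq_of_diff_zero M_mem add_closed free_star_on_add)
  with assms show ?thesis by (simp add: triangle M_mem)
qed

lemma q_M_smult:
  assumes "f \<in> carrier (cfun X)"
  shows "q (fgen (M (\<lambda>x. c * f x))) = cmod c * q (fgen (M f))"
proof -
  have "q (fgen (M (\<lambda>x. c * f x)) - fscale c (fgen (M f))) = 0"
    using rel_zero[OF cp_rels_intros(3)[OF assms]] by (simp add: cfun_def)
  then have "q (fgen (M (\<lambda>x. c * f x))) = q (fscale c (fgen (M f)))"
    using assms by (intro eq_of_diff_zero M_mem smult_closed free_star_on_fscale)
  with assms show ?thesis by (simp add: scale M_mem)
qed

lemma q_V_le: "q (fgen V) \<le> 1"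
proof -
  have "q (fadj (fgen V) * fgen V) = q 1"
    using rel_zero[OF cp_rels_intros(6)] V_mem by (intro eq_of_diff_zero free_star_on_closed) auto
  then have "(q (fgen V))\<^sup>2 \<le> 1"
    using cstar[OF V_mem] one_le by simp
  then show ?thesis using abs_square_le_1[of "q (fgen V)"] by simp
qed

text \<open>In the seminorm, \<open>M u\<close> inherits unitarity from \<open>u\<close>: its square
  is the seminorm of \<open>M u\<close> adjoint times \<open>M u\<close>, which the relations turn
  into that of \<open>M\<close> of the conjugate times \<open>M u\<close>, then of \<open>M\<close>
  of the unit, then of 1.\<close>

lemma q_M_unitary_le:
  assumes u: "u \<in> carrier (cfun X)" and unit: "\<And>x. x \<in> X \<Longrightarrow> cmod (u x) = 1"
  shows "q (fgen (M u)) \<le> 1"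
proof -
  let ?v = "\<lambda>x. cnj (u x)"
  have v: "?v \<in> carrier (cfun X)"
    using u by (auto simp: cfun_def intro: continuous_intros)
  have vu: "?v \<otimes>\<^bsub>cfun X\<^esub> u = \<one>\<^bsub>cfun X\<^esub>"
  proof
    fix x
    have "cnj (u x) * u x = 1" if "x \<in> X"
      using unit[OF that] by (metis complex_norm_square mult.commute of_real_1 power_one)
    with u show "(?v \<otimes>\<^bsub>cfun X\<^esub> u) x = \<one>\<^bsub>cfun X\<^esub> x"
      by (simp add: cfun_def)
  qed
  have one: "\<one>\<^bsub>cfun X\<^esub> \<in> carrier (cfun X)"
    using continuous_on_eq[OF continuous_on_const[of X "1::complex"]] by (auto simp: cfun_def)
  note mem = M_mem[OF u] M_mem[OF v] M_mem[OF one]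
  \<comment> \<open>The adjoint relation concerns a single letter. Submultiplicativity allows the
    replacement inside a product.\<close>
  have "q (fgen (M ?v) * fgen (M u) - fadj (fgen (M u)) * fgen (M u))
      = q ((fgen (M ?v) - fadj (fgen (M u))) * fgen (M u))"
    by (simp add: left_diff_distrib)
  also have "\<dots> \<le> q (fgen (M ?v) - fadj (fgen (M u))) * q (fgen (M u))"
    using mem by (intro submult free_star_on_closed)
  also have "\<dots> = 0"
    using rel_zero[OF cp_rels_intros(4)[OF u]] by (simp add: cfun_def)
  finally have "q (fgen (M ?v) * fgen (M u) - fadj (fgen (M u)) * fgen (M u)) = 0"
    using mem by (intro antisym nonneg free_star_on_closed)
  then have "(q (fgen (M u)))\<^sup>2 = q (fgen (M ?v) * fgen (M u))"
    using eq_of_diff_zero[of "fgen (M ?v) * fgen (M u)" "fadj (fgen (M u)) * fgen (M u)"] mem cstar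
    by (simp add: free_star_on_closed)
  also have "\<dots> = q (fgen (M \<one>\<^bsub>cfun X\<^esub>))"
    using rel_zero[OF cp_rels_intros(2)[OF v u]] mem unfolding vu
    by (intro eq_of_diff_zero[symmetric] free_star_on_closed)
  also have "\<dots> = q 1"
    using rel_zero[OF cp_rels_intros(5)] mem by (intro eq_of_diff_zero) auto
  finally have "(q (fgen (M u)))\<^sup>2 \<le> 1"
    using one_le by simp
  then show ?thesis using abs_square_le_1[of "q (fgen (M u))"] by simp
qed

text \<open>
  A real function of norm at most \<open>1\<close> is the average of the unitaries \<open>h \<plusminus> \<i> \<surd>(1 - h\<^sup>2)\<close>, so no
  spectral theory is needed to bound it.
\<close>
lemma q_M_real_le:
  fixes h :: "'x \<Rightarrow> real"
  assumes h: "continuous_on X h" "\<And>x. x \<in> X \<Longrightarrow> \<bar>h x\<bar> \<le> 1"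
  shows "q (fgen (M (\<lambda>x. if x \<in> X then complex_of_real (h x) else 0))) \<le> 1"
proof -
  \<comment> \<open>\<open>s\<close> is the sign of the imaginary part, used at 1 and -1 so that the
    imaginary parts cancel in the average. The value 0 off \<open>X\<close> is the normalisation of
    \<open>cfun\<close>.\<close>
  define u where "u s x = (if x \<in> X then Complex (h x) (s * sqrt (1 - (h x)\<^sup>2)) else 0)" for s x
  have u: "u s \<in> carrier (cfun X)" for s
  proof -
    have "continuous_on X (\<lambda>x. Complex (h x) (s * sqrt (1 - (h x)\<^sup>2)))"
      using h(1) unfolding Complex_eq by (intro continuous_intros)
    then have "continuous_on X (u s)"
      by (rule continuous_on_eq) (simp add: u_def)
    then show ?thesis by (simp add: cfun_def u_def)
  qed
  have le: "q (fgen (M (u s))) \<le> 1" if "s\<^sup>2 = 1" for s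
    using u
  proof (rule q_M_unitary_le)
    fix x assume x: "x \<in> X"
    then have "(h x)\<^sup>2 \<le> 1" using h(2) by (simp add: abs_square_le_1)
    with x that show "cmod (u s x) = 1"
      by (simp add: u_def cmod_def power_mult_distrib)
  qed
  have "(\<lambda>x. if x \<in> X then complex_of_real (h x) else 0) = (\<lambda>x. 1/2 * u 1 x + 1/2 * u (-1) x)"
    by (auto simp: u_def complex_eq_iff)
  moreover have "q (fgen (M (\<lambda>x. 1/2 * u 1 x + 1/2 * u (-1) x))) \<le> 1/2 * q (fgen (M (u 1))) + 1/2 * q (fgen (M (u (-1))))"
    using q_M_add[OF smult_closed[OF u] smult_closed[OF u], of "1/2" 1 "1/2" "-1"] u
    by (simp only: q_M_smult) simp
  ultimately show ?thesis using le[of 1] le[of "-1"] by simp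
qed

text \<open>Real and imaginary parts, scaled by \<open>K\<close>, contribute \<open>K\<close> each.
  The factor 2 is harmless because only uniformity in \<open>q\<close> matters.\<close>

lemma q_M_le:
  assumes f: "f \<in> carrier (cfun X)" and K: "K > 0" "\<And>x. x \<in> X \<Longrightarrow> cmod (f x) \<le> K"
  shows "q (fgen (M f)) \<le> 2 * K"
proof -
  define R I where "R x = (if x \<in> X then complex_of_real (Re (f x) / K) else 0)"
    and "I x = (if x \<in> X then complex_of_real (Im (f x) / K) else 0)" for x
  have cont: "continuous_on X f" using f by (simp add: cfun_def)
  then have contR: "continuous_on X (\<lambda>x. Re (f x) / K)" and contI: "continuous_on X (\<lambda>x. Im (f x) / K)"
    using K(1) by (intro continuous_intros; simp)+
  have bound: "\<bar>Re (f x) / K\<bar> \<le> 1" "\<bar>Im (f x) / K\<bar> \<le> 1" if "x \<in> X" for x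
    using K(1) K(2)[OF that] abs_Re_le_cmod[of "f x"] abs_Im_le_cmod[of "f x"] by auto
  have "continuous_on X (\<lambda>x. complex_of_real (Re (f x) / K))" "continuous_on X (\<lambda>x. complex_of_real (Im (f x) / K))"
    by (rule continuous_on_of_real[OF contR], rule continuous_on_of_real[OF contI])
  then have "continuous_on X R" "continuous_on X I"
    by (auto elim!: continuous_on_eq simp: R_def I_def)
  then have mem: "R \<in> carrier (cfun X)" "I \<in> carrier (cfun X)"
    by (auto simp: cfun_def R_def I_def)
  have le: "q (fgen (M R)) \<le> 1" "q (fgen (M I)) \<le> 1"
    unfolding R_def[abs_def] I_def[abs_def] using contR contI bound by (auto intro!: q_M_real_le)
  have "f = (\<lambda>x. of_real K * R x + (\<i> * of_real K) * I x)"
    using f K(1) by (auto simp: R_def I_def cfun_def complex_eq_iff)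
  then have "q (fgen (M f)) = q (fgen (M (\<lambda>x. of_real K * R x + (\<i> * of_real K) * I x)))"
    by (rule arg_cong[where f = "\<lambda>f. q (fgen (M f))"])
  also have "\<dots> \<le> K * q (fgen (M R)) + K * q (fgen (M I))"
    using q_M_add[OF smult_closed[OF mem(1)] smult_closed[OF mem(2)], of "of_real K" "\<i> * of_real K"] K(1)
    by (simp only: q_M_smult[OF mem(1)] q_M_smult[OF mem(2)] norm_mult norm_ii norm_of_real)
  also have "\<dots> \<le> K * 1 + K * 1"
    using K(1) le by (intro add_mono mult_left_mono) auto
  finally show ?thesis by simp
qed

end

text \<open>Compactness makes each \<open>f\<close> bounded, which supplies the \<open>K\<close> of
  \<open>q_M_le\<close>.\<close>

lemma cfun_cp_seminorms_bdd_above: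
  fixes X :: "'x::topological_space set"
  assumes "compact X" and x: "x \<in> free_star_on (cp_gens (cfun X))"
  shows "bdd_above {q x |q. cstar_seminorm (cp_gens (cfun X)) (cp_rels (cfun X) \<alpha>) q}"
proof (rule cstar_seminorms_bdd_above[OF _ x])
  fix g assume "g \<in> cp_gens (cfun X)"
  then consider "g = V" | f where "g = M f" "f \<in> carrier (cfun X)"
    by (auto simp: cp_gens_def)
  then show "\<exists>B. \<forall>q. cstar_seminorm (cp_gens (cfun X)) (cp_rels (cfun X) \<alpha>) q \<longrightarrow> q (fgen g) \<le> B"
  proof cases
    case 1
    then show ?thesis
      using cfun_cp_seminorm.q_V_le cfun_cp_seminorm.intro by blast
  next
    case 2
    then have "compact (f ` X)"
      using \<open>compact X\<close> by (intro compact_continuous_image) (auto simp: cfun_def)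
    then obtain K where K: "K > 0" "\<And>x. x \<in> X \<Longrightarrow> cmod (f x) \<le> K"
      using compact_imp_bounded bounded_pos by (metis imageI)
    have "q (fgen g) \<le> 2 * K" if "cstar_seminorm (cp_gens (cfun X)) (cp_rels (cfun X) \<alpha>) q" for q
      using cfun_cp_seminorm.q_M_le[OF cfun_cp_seminorm.intro[OF that] 2(2) K] 2(1) by simp
    then show ?thesis by blast
  qed
qed

section \<open>Pulling functions back along a homeomorphism\<close>

definition pullback :: "'y set \<Rightarrow> ('y \<Rightarrow> 'x) \<Rightarrow> ('x \<Rightarrow> complex) \<Rightarrow> 'y \<Rightarrow> complex" where
  "pullback Y b f y = (if y \<in> Y then f (b y) else 0)"

lemma cp_morphism_pullback:
  assumes b: "continuous_on Y b" "b ` Y \<subseteq> X"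
    and intertwines: "\<And>f. f \<in> carrier (cfun X) \<Longrightarrow> pullback Y b (\<alpha> f) = \<beta> (pullback Y b f)"
  shows "cp_morphism (cfun X) (cfun Y) \<alpha> \<beta> (pullback Y b)"
proof
  fix f assume f: "f \<in> carrier (cfun X)"
  then have "continuous_on Y (\<lambda>y. f (b y))"
    using b by (auto simp: cfun_def intro: continuous_on_compose2)
  then have "continuous_on Y (pullback Y b f)"
    by (rule continuous_on_eq) (simp add: pullback_def)
  then show "pullback Y b f \<in> carrier (cfun Y)"
    by (simp add: cfun_def pullback_def)
  show "pullback Y b (\<alpha> f) = \<beta> (pullback Y b f)"
    using f by (rule intertwines)
qed (use b in \<open>auto simp: cfun_def pullback_def fun_eq_iff\<close>)

lemma crossed_product_cfun_isomorphic:
  assumes hom: "homeomorphism X Y a b" and "compact X" "compact Y"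
    and "\<And>f. f \<in> carrier (cfun X) \<Longrightarrow> pullback Y b (\<alpha> f) = \<beta> (pullback Y b f)"
    and "\<And>f. f \<in> carrier (cfun Y) \<Longrightarrow> pullback X a (\<beta> f) = \<alpha> (pullback X a f)"
  shows "crossed_product (cfun X) \<alpha> \<cong>\<^sub>C crossed_product (cfun Y) \<beta>"
proof (rule crossed_product_isomorphic)
  show "cp_morphism (cfun X) (cfun Y) \<alpha> \<beta> (pullback Y b)"
    using assms by (intro cp_morphism_pullback) (auto simp: homeomorphism_def)
  show "cp_morphism (cfun Y) (cfun X) \<beta> \<alpha> (pullback X a)"
    using assms by (intro cp_morphism_pullback) (auto simp: homeomorphism_def)
  show "pullback X a (pullback Y b f) = f" if "f \<in> carrier (cfun X)" for f
    using hom that by (auto simp: pullback_def cfun_def homeomorphism_def fun_eq_iff)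
  show "pullback Y b (pullback X a f) = f" if "f \<in> carrier (cfun Y)" for f
    using hom that by (auto simp: pullback_def cfun_def homeomorphism_def fun_eq_iff)
qed (rule cfun_cp_seminorms_bdd_above[OF assms(2)], assumption,
  rule cfun_cp_seminorms_bdd_above[OF assms(3)], assumption)

section \<open>Changing the base from \<open>s\<close> to \<open>r\<close>\<close>

lemma adic_ints_iff:
  "x \<in> carrier (adic_ints s) \<longleftrightarrow> (\<forall>n. 0 \<le> x n \<and> x n < int s ^ n \<and> x (Suc n) mod int s ^ n = x n)"
  by (simp add: adic_ints_def)

lemma adic_mult: "(x \<otimes>\<^bsub>adic_ints s\<^esub> y) n = (x n * y n) mod int s ^ n"
  by (simp add: adic_ints_def)

lemma adic_range:
  assumes "x \<in> carrier (adic_ints s)" shows "0 \<le> x n" "x n < int s ^ n" "x n mod int s ^ n = x n"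
  using assms by (auto simp: adic_ints_iff)

lemma adic_mod:
  assumes "x \<in> carrier (adic_ints s)" "m \<le> n" shows "x n mod int s ^ m = x m"
  using assms(2)
proof (induction rule: dec_induct)
  case (step n)
  have "x (Suc n) mod int s ^ m = x (Suc n) mod int s ^ n mod int s ^ m"
    using step by (simp add: mod_mod_cancel le_imp_power_dvd)
  with step assms(1) show ?case by (simp add: adic_ints_iff)
qed (simp add: adic_range assms)

lemma adic_mult_closed:
  assumes "x \<in> carrier (adic_ints s)" "y \<in> carrier (adic_ints s)" "s > 0"
  shows "x \<otimes>\<^bsub>adic_ints s\<^esub> y \<in> carrier (adic_ints s)"
  unfolding adic_ints_iff adic_mult
proof (intro allI conjI)
  fix n
  have "x (Suc n) * y (Suc n) mod int s ^ n = (x (Suc n) mod int s ^ n) * (y (Suc n) mod int s ^ n) mod int s ^ n"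
    by (simp add: mod_mult_eq)
  with assms show "x (Suc n) * y (Suc n) mod int s ^ Suc n mod int s ^ n = x n * y n mod int s ^ n"
    by (simp add: mod_mod_cancel adic_ints_iff)
qed (use assms in auto)

lemma adic_of_int_closed: "s > 0 \<Longrightarrow> adic_of_int s k \<in> carrier (adic_ints s)"
  by (simp add: adic_ints_iff adic_of_int_def mod_mod_cancel)

text \<open>As \<open>int\<close> is discrete, \<open>g\<close> is automatically continuous. Maps
  whose every output coordinate depends on one input coordinate thus need no further continuity
  argument.\<close>

lemma continuous_on_coordinate:
  fixes g :: "int \<Rightarrow> int"
  shows "continuous_on X (\<lambda>x :: nat \<Rightarrow> int. g (x i))"
proof -
  have "continuous_on X (g \<circ> (\<lambda>x. x i))"
    by (intro continuous_on_compose Topological_Spaces.continuous_on_discrete continuous_on_subset[OF continuous_on_product_coordinates]) simp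
  then show ?thesis by (simp add: comp_def)
qed

text \<open>A closed subset of a product of finite sets, compact by Tychonoff.\<close>

lemma compact_adic_ints: "compact (carrier (adic_ints s))"
proof -
  let ?K = "PiE UNIV (\<lambda>n. {0..<int s ^ n})"
  let ?L = "\<Inter>n. {x. x (Suc n) mod int s ^ n = x n}"
  have "compactin (product_topology (\<lambda>_. euclidean) UNIV) ?K"
    unfolding compactin_PiE by (auto intro: finite_imp_compact)
  then have "compact ?K"
    by (simp add: euclidean_product_topology)
  moreover have "closed ?L"
    by (intro closed_INT ballI closed_Collect_eq continuous_on_coordinate continuous_on_product_coordinates)
  ultimately have "compact (?K \<inter> ?L)" by (rule compact_Int_closed)
  also have "?K \<inter> ?L = carrier (adic_ints s)"
    by (auto simp: adic_ints_iff PiE_iff)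
  finally show ?thesis .
qed

text \<open>If the first residue vanished, a factor \<open>p\<close> could be split off, the
  exponent in the norm would be at least 1 and the norm less than 1.\<close>

lemma padic_norm_one_imp_unit:
  assumes "prime p" and x: "x \<in> carrier (adic_ints p)" and norm: "padic_norm p x = 1"
  shows "x 1 \<noteq> 0"
proof
  assume "x 1 = 0"
  let ?P = "\<lambda>k. \<exists>y\<in>carrier (adic_ints p). x = adic_of_int p (int p ^ k) \<otimes>\<^bsub>adic_ints p\<^esub> y"
  have p: "p > 1" using \<open>prime p\<close> by (rule prime_gt_1_nat)
  have "x \<noteq> \<zero>\<^bsub>adic_ints p\<^esub>"
    using norm by (auto simp: padic_norm_def)
  then obtain m where m: "x m \<noteq> 0"
    by (auto simp: adic_ints_def)
  \<comment> \<open>\<open>GREATEST\<close> needs a bounded predicate: a factor \<open>p ^ k\<close>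
    with \<open>k > m\<close> would kill the nonzero residue \<open>x m\<close>.\<close>
  have bound: "k \<le> m" if "?P k" for k
  proof (rule ccontr)
    assume "\<not> k \<le> m"
    then have "int p ^ k mod int p ^ m = 0"
      by (simp add: le_imp_power_dvd mod_eq_0_iff_dvd)
    with that m show False by (auto simp: adic_mult adic_of_int_def)
  qed
  \<comment> \<open>Division by \<open>p\<close> costs one level, so the quotient modulo
    \<open>p ^ n\<close> is read off from \<open>x\<close> modulo \<open>p ^ Suc n\<close>.\<close>
  define y where "y n = x (Suc n) div int p" for n
  have dvd: "int p * y n = x (Suc n)" for n
    using adic_mod[OF x, of 1 "Suc n"] \<open>x 1 = 0\<close> by (auto simp: y_def)
  have "y \<in> carrier (adic_ints p)"
    unfolding adic_ints_iff
  proof (intro allI conjI)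
    fix n
    show "0 \<le> y n" using adic_range[OF x] p by (simp add: y_def pos_imp_zdiv_nonneg_iff)
    have "int p * y n < int p * int p ^ n"
      using adic_range(2)[OF x, of "Suc n"] by (simp add: dvd)
    then show "y n < int p ^ n" using p by simp
    have "int p * (y (Suc n) mod int p ^ n) = int p * y n"
      using x by (simp add: mult_mod_right dvd adic_ints_iff flip: power_Suc)
    then show "y (Suc n) mod int p ^ n = y n" using p by simp
  qed
  moreover have "x = adic_of_int p (int p ^ 1) \<otimes>\<^bsub>adic_ints p\<^esub> y"
  proof
    fix n
    have "(int p mod int p ^ n) * y n mod int p ^ n = int p * y n mod int p ^ n"
      by (simp add: mod_mult_left_eq)
    with x show "x n = (adic_of_int p (int p ^ 1) \<otimes>\<^bsub>adic_ints p\<^esub> y) n"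
      by (simp add: adic_mult adic_of_int_def dvd adic_ints_iff)
  qed
  ultimately have "1 \<le> Greatest ?P"
    by (intro Greatest_le_nat[of ?P 1 m]) (use bound in blast)+
  moreover have "(1 / real p) ^ Greatest ?P = 1"
    using norm \<open>x \<noteq> \<zero>\<^bsub>adic_ints p\<^esub>\<close> by (simp add: padic_norm_def)
  ultimately show False
    using p power_Suc_less_one[of "1 / real p" "Greatest ?P - 1"] by simp
qed

lemma shift_endo_mult:
  assumes "y \<in> carrier (adic_ints s)"
    and "inj_on (\<lambda>y. r \<otimes>\<^bsub>adic_ints s\<^esub> y) (carrier (adic_ints s))"
  shows "shift_endo s r f (r \<otimes>\<^bsub>adic_ints s\<^esub> y) = f y"
proof -
  have "(THE y'. y' \<in> carrier (adic_ints s) \<and> r \<otimes>\<^bsub>adic_ints s\<^esub> y = r \<otimes>\<^bsub>adic_ints s\<^esub> y') = y"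
    using assms by (auto simp: inj_on_def)
  with assms(1) show ?thesis by (auto simp: shift_endo_def)
qed

lemma shift_endo_zero:
  "x \<notin> (\<lambda>y. r \<otimes>\<^bsub>adic_ints s\<^esub> y) ` carrier (adic_ints s) \<Longrightarrow> shift_endo s r f x = 0"
  by (auto simp: shift_endo_def)

text \<open>
  \<open>\<theta> n\<close> sends the base \<open>s\<close> expansion \<open>\<Sum> a\<^sub>i s\<^sup>i\<close> to \<open>\<Sum> a\<^sub>i r\<^sup>i\<close> modulo \<open>s\<^sup>n = p\<^bsup>N n\<^esup>\<close>, where \<open>r = r' s\<close>.
  It is a permutation of the residues modulo \<open>s\<^sup>n\<close>, and the limit of these is the homeomorphism
  from \<open>\<int>\<^sub>s\<close> to \<open>\<int>\<^sub>p\<close> that turns multiplication by \<open>s\<close> into multiplication by \<open>r\<close>.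
\<close>
locale adic_base_change =
  fixes p N s :: nat and r r' :: "nat \<Rightarrow> int"
  assumes prime: "prime p" and N: "N \<ge> 1" and s_eq: "s = p ^ N"
    and r': "r' \<in> carrier (adic_ints p)" "r' 1 \<noteq> 0"
    and r_eq: "r = r' \<otimes>\<^bsub>adic_ints p\<^esub> adic_of_int p (int p ^ N)"
begin

abbreviation "S \<equiv> int s"
abbreviation "Zp \<equiv> carrier (adic_ints p)"
abbreviation "Zs \<equiv> carrier (adic_ints s)"
abbreviation "\<sigma> \<equiv> adic_of_int s S"

lemma p_gt_1: "p > 1"
  using prime by (rule prime_gt_1_nat)

lemma S_pos: "S > 0"
  using p_gt_1 by (simp add: s_eq)

lemma p_power: "int p ^ (N * n) = S ^ n"
  by (simp add: s_eq power_mult)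

lemma p_power_dvd: "int p ^ n dvd S ^ n"
  using N by (simp add: le_imp_power_dvd flip: p_power)

lemma r_closed: "r \<in> Zp"
  unfolding r_eq using r' p_gt_1 by (intro adic_mult_closed adic_of_int_closed) auto

text \<open>The unit factor of \<open>r\<close> modulo \<open>S ^ n\<close>: level
  \<open>N * n\<close> of the p-adic integers has modulus \<open>S ^ n\<close>.\<close>

definition w :: "nat \<Rightarrow> int" where
  "w n = r' (N * n)"

lemma w_mod: "w (Suc n) mod S ^ n = w n"
  using adic_mod[OF r'(1), of "N * n" "N * Suc n"] by (simp add: w_def p_power)

lemma coprime_w: "coprime (w n) (S ^ n)"
proof (cases n)
  case (Suc m)
  have "r' (N * n) mod int p = r' 1"
    using adic_mod[OF r'(1), of 1 "N * n"] N Suc by simp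
  with r'(2) have "\<not> int p dvd w n"
    by (auto simp: w_def)
  then have "coprime (int p) (w n)"
    using prime by (intro prime_imp_coprime) auto
  then show ?thesis
    by (simp add: coprime_commute flip: p_power)
qed simp

text \<open>The factor \<open>S\<close> gains one level, so \<open>r\<close> modulo
  \<open>S ^ Suc n\<close> is already fixed by \<open>r'\<close> modulo
  \<open>S ^ n\<close>.\<close>

lemma r_level: "r (N * Suc n) = w n * S"
proof -
  have "r (N * Suc n) = r' (N * Suc n) * (S mod S ^ Suc n) mod S ^ Suc n"
    unfolding r_eq adic_mult adic_of_int_def p_power by (simp only: s_eq of_nat_power)
  also have "\<dots> = (r' (N * Suc n) * S) mod (S ^ n * S)"
    by (simp only: mod_mult_right_eq power_Suc2)
  also have "\<dots> = (r' (N * Suc n) mod S ^ n) * S"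
    by (rule mod_mult_mult2)
  also have "r' (N * Suc n) mod S ^ n = w n"
    using w_mod by (simp add: w_def)
  finally show ?thesis .
qed

text \<open>The levels \<open>N * n\<close> are cofinal, and every lower residue is a reduction of a
  higher one.\<close>

lemma adic_ext_levels:
  assumes "x \<in> Zp" "y \<in> Zp" "\<And>n. x (N * n) = y (N * n)"
  shows "x = y"
proof
  fix n
  have "n \<le> N * n" using N by simp
  with assms show "x n = y n" by (metis adic_mod)
qed

text \<open>Horner form: the lowest digit plus \<open>r\<close> times the image of the remaining
  digits, with \<open>r\<close> replaced by its residue \<open>w n * S\<close> from
  \<open>r_level\<close>. The tail is known only modulo \<open>S ^ n\<close>; the factor
  \<open>S\<close> supplies the missing level.\<close>

primrec \<theta> :: "nat \<Rightarrow> int \<Rightarrow> int" where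
  "\<theta> 0 a = 0"
| "\<theta> (Suc n) a = (a mod S + w n * S * \<theta> n (a div S)) mod S ^ Suc n"

lemma theta_range: "0 \<le> \<theta> n a" "\<theta> n a < S ^ n"
  using S_pos by (cases n; simp)+

text \<open>The lowest digit survives truncation. In the tail \<open>w\<close> and, by induction,
  \<open>\<theta>\<close> reduce correctly modulo \<open>S ^ n\<close>, and the factor
  \<open>S\<close> lifts this to \<open>S ^ Suc n\<close>. It makes the finite maps compatible with
  the inverse limit.\<close>

lemma theta_mod: "\<theta> (Suc n) a mod S ^ n = \<theta> n (a mod S ^ n)"
proof (induction n arbitrary: a)
  case (Suc n)
  let ?t = "\<theta> (Suc n) (a div S)"
  have digit: "a mod S ^ Suc n mod S = a mod S"
    by (simp add: mod_mod_cancel)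
  have shift: "a mod S ^ Suc n div S = a div S mod S ^ n"
    using S_pos zmod_zmult2_eq[of "S ^ n" a S] by simp
  have "(w (Suc n) * ?t) mod S ^ n = (w n * \<theta> n (a div S mod S ^ n)) mod S ^ n"
    using mod_mult_eq[of "w (Suc n)" "S ^ n" ?t] by (simp only: w_mod Suc.IH)
  then have "(S * (w (Suc n) * ?t)) mod (S * S ^ n) = (S * (w n * \<theta> n (a div S mod S ^ n))) mod (S * S ^ n)"
    by (simp only: mult_mod_right[symmetric])
  then have step: "(w (Suc n) * S * ?t) mod S ^ Suc n = (w n * S * \<theta> n (a div S mod S ^ n)) mod S ^ Suc n"
    by (simp only: power_Suc mult_ac)
  have "\<theta> (Suc (Suc n)) a mod S ^ Suc n = (a mod S + w (Suc n) * S * ?t) mod S ^ Suc n"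
    by (simp only: \<theta>.simps(2)[of "Suc n"] mod_mod_cancel le_imp_power_dvd le_SucI le_refl)
  also have "\<dots> = (a mod S + w n * S * \<theta> n (a div S mod S ^ n)) mod S ^ Suc n"
    using step by (metis mod_add_right_eq)
  also have "\<dots> = \<theta> (Suc n) (a mod S ^ Suc n)"
    by (simp only: \<theta>.simps digit shift)
  finally show ?case .
qed simp

text \<open>All later digits enter with a factor \<open>S\<close>, so reducing modulo
  \<open>S\<close> recovers the lowest digit. After removing it and cancelling \<open>S\<close>, the
  factor \<open>w n\<close> cancels because it is coprime to \<open>S ^ n\<close>, and induction
  applies to the quotients. Here the unit property of \<open>r'\<close> is decisive.\<close>

lemma theta_inj: "inj_on (\<theta> n) {0..<S ^ n}"
proof (induction n)
  case (Suc n)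
  show ?case
  proof (rule inj_onI)
    fix a b assume a: "a \<in> {0..<S ^ Suc n}" and b: "b \<in> {0..<S ^ Suc n}"
      and eq: "\<theta> (Suc n) a = \<theta> (Suc n) b"
    have digit: "\<theta> (Suc n) c mod S = c mod S" for c
      by (simp add: mod_mod_cancel) (metis mod_mult_self2 mod_mod_trivial mult.assoc mult.commute)
    then have low: "a mod S = b mod S"
      using eq by metis
    have quot: "c div S \<in> {0..<S ^ n}" if "c \<in> {0..<S ^ Suc n}" for c
    proof -
      have "S * (c div S) \<le> c"
        using S_pos mult_div_mod_eq[of S c] pos_mod_sign[of S c] by linarith
      also have "c < S * S ^ n"
        using that by simp
      finally have "c div S < S ^ n"
        using S_pos by (simp only: mult_less_cancel_left_pos)
      with that S_pos show ?thesis
        by (simp add: pos_imp_zdiv_nonneg_iff)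
    qed
    have "S ^ Suc n dvd (a mod S + w n * S * \<theta> n (a div S)) - (b mod S + w n * S * \<theta> n (b div S))"
      using eq by (simp only: \<theta>.simps mod_eq_dvd_iff)
    then have "S * S ^ n dvd S * (w n * (\<theta> n (a div S) - \<theta> n (b div S)))"
      by (simp add: low algebra_simps)
    then have "S ^ n dvd w n * (\<theta> n (a div S) - \<theta> n (b div S))"
      using S_pos by simp
    then have "S ^ n dvd \<theta> n (a div S) - \<theta> n (b div S)"
      using coprime_w[of n] by (simp only: coprime_commute coprime_dvd_mult_right_iff)
    then have "\<theta> n (a div S) mod S ^ n = \<theta> n (b div S) mod S ^ n"
      by (simp only: mod_eq_dvd_iff)
    then have "\<theta> n (a div S) = \<theta> n (b div S)"
      using theta_range by (metis mod_pos_pos_trivial)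
    then have "a div S = b div S"
      using Suc quot a b by (meson inj_onD)
    with low show "a = b" by (metis div_mult_mod_eq)
  qed
qed (simp add: inj_on_def)

text \<open>Finiteness turns injectivity into surjectivity, so digits never have to be computed from
  a given residue.\<close>

lemma theta_image: "\<theta> n ` {0..<S ^ n} = {0..<S ^ n}"
  using theta_range theta_inj by (intro endo_inj_surj) auto

text \<open>Level \<open>k\<close> of the source is finer than required, as \<open>p ^ k\<close>
  divides \<open>S ^ k\<close>. Using it avoids rounding \<open>k / N\<close> and makes each
  coordinate depend on a single coordinate of \<open>y\<close>.\<close>

definition \<psi> :: "(nat \<Rightarrow> int) \<Rightarrow> nat \<Rightarrow> int" where
  "\<psi> y k = \<theta> k (y k) mod int p ^ k"

definition \<psi>_inv :: "(nat \<Rightarrow> int) \<Rightarrow> nat \<Rightarrow> int" where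
  "\<psi>_inv x k = inv_into {0..<S ^ k} (\<theta> k) (x (N * k))"

lemma theta_adic:
  assumes y: "y \<in> Zs" shows "(\<lambda>n. \<theta> n (y n)) \<in> Zs"
  using y theta_range theta_mod by (simp add: adic_ints_iff)

lemma psi_closed:
  assumes y: "y \<in> Zs" shows "\<psi> y \<in> Zp"
  unfolding adic_ints_iff
proof (intro allI conjI)
  fix n
  have "\<theta> (Suc n) (y (Suc n)) mod S ^ n mod int p ^ n = \<theta> n (y n) mod int p ^ n"
    using theta_adic[OF y] by (simp add: adic_ints_iff)
  then show "\<psi> y (Suc n) mod int p ^ n = \<psi> y n"
    using p_power_dvd by (simp add: \<psi>_def mod_mod_cancel)
qed (use p_gt_1 in \<open>auto simp: \<psi>_def\<close>)

text \<open>By definition the left side involves \<open>\<theta>\<close> at level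
  \<open>N * n\<close>; compatibility of the levels brings it down to \<open>n\<close>.\<close>

lemma psi_level:
  assumes y: "y \<in> Zs" shows "\<psi> y (N * n) = \<theta> n (y n)"
proof -
  have "n \<le> N * n" using N by simp
  from adic_mod[OF theta_adic[OF y] this] show ?thesis
    by (simp add: \<psi>_def p_power)
qed

lemma psi_inv_level:
  assumes x: "x \<in> Zp" shows "\<psi>_inv x k \<in> {0..<S ^ k}" "\<theta> k (\<psi>_inv x k) = x (N * k)"
proof -
  have "x (N * k) \<in> \<theta> k ` {0..<S ^ k}"
    using adic_range[OF x, of "N * k"] unfolding theta_image p_power by simp
  then show "\<psi>_inv x k \<in> {0..<S ^ k}" "\<theta> k (\<psi>_inv x k) = x (N * k)"
    unfolding \<psi>_inv_def by (rule inv_into_into, rule f_inv_into_f)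
qed

text \<open>Compatibility of consecutive levels is checked after applying the injective
  \<open>\<theta> n\<close>, where it becomes compatibility of the residues of
  \<open>x\<close>.\<close>

lemma psi_inv_closed:
  assumes x: "x \<in> Zp" shows "\<psi>_inv x \<in> Zs"
  unfolding adic_ints_iff
proof (intro allI conjI)
  fix n
  have "\<theta> n (\<psi>_inv x (Suc n) mod S ^ n) = x (N * Suc n) mod int p ^ (N * n)"
    using x by (simp only: psi_inv_level p_power flip: theta_mod)
  also have "\<dots> = \<theta> n (\<psi>_inv x n)"
    using adic_mod[OF x, of "N * n" "N * Suc n"] x by (simp add: psi_inv_level)
  finally show "\<psi>_inv x (Suc n) mod S ^ n = \<psi>_inv x n"
  proof (rule inj_onD[OF theta_inj])
    show "\<psi>_inv x (Suc n) mod S ^ n \<in> {0..<S ^ n}" using S_pos by simp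
    show "\<psi>_inv x n \<in> {0..<S ^ n}" using x by (rule psi_inv_level)
  qed
  show "0 \<le> \<psi>_inv x n" "\<psi>_inv x n < S ^ n"
    using psi_inv_level(1)[OF x, of n] by simp_all
qed

lemma psi_inv_psi:
  assumes y: "y \<in> Zs" shows "\<psi>_inv (\<psi> y) = y"
proof
  fix n
  show "\<psi>_inv (\<psi> y) n = y n"
    unfolding \<psi>_inv_def psi_level[OF y] using adic_range[OF y, of n]
    by (intro inv_into_f_f theta_inj) simp
qed

lemma psi_psi_inv:
  assumes x: "x \<in> Zp" shows "\<psi> (\<psi>_inv x) = x"
proof (rule adic_ext_levels[OF _ x])
  show "\<psi> (\<psi>_inv x) \<in> Zp"
    using x by (intro psi_closed psi_inv_closed)
  show "\<psi> (\<psi>_inv x) (N * n) = x (N * n)" for n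
    unfolding psi_level[OF psi_inv_closed[OF x]] by (rule psi_inv_level(2)[OF x])
qed

lemma homeomorphism_psi: "homeomorphism Zp Zs \<psi>_inv \<psi>"
proof (rule homeomorphismI)
  show "continuous_on Zp \<psi>_inv"
    unfolding \<psi>_inv_def[abs_def] by (intro continuous_on_coordinatewise_then_product continuous_on_coordinate)
  show "continuous_on Zs \<psi>"
    unfolding \<psi>_def[abs_def] by (intro continuous_on_coordinatewise_then_product continuous_on_coordinate)
qed (auto simp: psi_closed psi_inv_closed psi_psi_inv psi_inv_psi)

section \<open>Multiplication by s corresponds to multiplication by r\<close>

lemma mult_s_level:
  assumes "y \<in> Zs" shows "(\<sigma> \<otimes>\<^bsub>adic_ints s\<^esub> y) (Suc n) = S * y n"
proof -
  have "(\<sigma> \<otimes>\<^bsub>adic_ints s\<^esub> y) (Suc n) = (S * y (Suc n)) mod (S * S ^ n)"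
    by (simp only: adic_mult adic_of_int_def mod_mult_left_eq power_Suc)
  \<comment> \<open>The factor \<open>S\<close> raises the modulus by one power, so level
    \<open>n\<close> of \<open>y\<close> determines level \<open>Suc n\<close> of the
    product.\<close>
  also have "\<dots> = S * y n"
    using assms by (simp only: adic_ints_iff mult_mod_right[symmetric])
  finally show ?thesis .
qed

lemma inj_mult_s: "inj_on (\<lambda>y. \<sigma> \<otimes>\<^bsub>adic_ints s\<^esub> y) Zs"
proof (intro inj_onI ext)
  fix y z n assume "y \<in> Zs" "z \<in> Zs" "\<sigma> \<otimes>\<^bsub>adic_ints s\<^esub> y = \<sigma> \<otimes>\<^bsub>adic_ints s\<^esub> z"
  then have "S * y n = S * z n"
    by (metis mult_s_level)
  then show "y n = z n" using S_pos by simp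
qed

lemma mult_s_closed: "y \<in> Zs \<Longrightarrow> \<sigma> \<otimes>\<^bsub>adic_ints s\<^esub> y \<in> Zs"
  using S_pos by (intro adic_mult_closed adic_of_int_closed) auto

lemma mult_r_closed: "x \<in> Zp \<Longrightarrow> r \<otimes>\<^bsub>adic_ints p\<^esub> x \<in> Zp"
  using p_gt_1 by (intro adic_mult_closed r_closed) auto

text \<open>Multiplying by \<open>s\<close> prepends the digit 0, and the recursion for
  \<open>\<theta>\<close> then leaves exactly the factor \<open>w n * S\<close>, which is
  \<open>r\<close> at level \<open>N * Suc n\<close>. At level 0 the modulus is 1.\<close>

lemma psi_mult_s:
  assumes y: "y \<in> Zs"
  shows "\<psi> (\<sigma> \<otimes>\<^bsub>adic_ints s\<^esub> y) = r \<otimes>\<^bsub>adic_ints p\<^esub> \<psi> y"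
proof (rule adic_ext_levels)
  fix k
  show "\<psi> (\<sigma> \<otimes>\<^bsub>adic_ints s\<^esub> y) (N * k) = (r \<otimes>\<^bsub>adic_ints p\<^esub> \<psi> y) (N * k)"
  proof (cases k)
    case 0
    then show ?thesis by (simp add: \<psi>_def adic_mult)
  next
    case (Suc n)
    have "(r \<otimes>\<^bsub>adic_ints p\<^esub> \<psi> y) (N * k) = (w n * S * \<theta> (Suc n) (y (Suc n))) mod S ^ Suc n"
      unfolding Suc adic_mult r_level p_power psi_level[OF y] ..
    also have "\<dots> = (S * (w n * \<theta> (Suc n) (y (Suc n)))) mod (S * S ^ n)"
      by (simp only: power_Suc mult_ac)
    also have "\<dots> = S * ((w n * (\<theta> (Suc n) (y (Suc n)) mod S ^ n)) mod S ^ n)"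
      by (simp only: mod_mult_mult1 mod_mult_right_eq)
    also have "\<theta> (Suc n) (y (Suc n)) mod S ^ n = \<theta> n (y n)"
      using theta_adic[OF y] by (simp only: adic_ints_iff)
    also have "S * ((w n * \<theta> n (y n)) mod S ^ n) = (w n * S * \<theta> n (y n)) mod S ^ Suc n"
      by (simp only: mult_mod_right power_Suc mult_ac)
    \<comment> \<open>The lowest digit of \<open>S * y n\<close> is 0 and its quotient by
      \<open>S\<close> is \<open>y n\<close>.\<close>
    also have "\<dots> = \<theta> (Suc n) (S * y n)"
      using S_pos by simp
    also have "\<dots> = \<psi> (\<sigma> \<otimes>\<^bsub>adic_ints s\<^esub> y) (N * k)"
      unfolding Suc psi_level[OF mult_s_closed[OF y]] mult_s_level[OF y] ..
    finally show ?thesis ..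
  qed
qed (use y in \<open>auto intro!: psi_closed mult_s_closed mult_r_closed\<close>)

lemma psi_inv_mult_r: "x \<in> Zp \<Longrightarrow> \<psi>_inv (r \<otimes>\<^bsub>adic_ints p\<^esub> x) = \<sigma> \<otimes>\<^bsub>adic_ints s\<^esub> \<psi>_inv x"
  by (metis psi_inv_closed psi_inv_psi mult_s_closed psi_psi_inv psi_mult_s)

text \<open>Transported along \<open>\<psi>_inv\<close> from multiplication by \<open>s\<close>,
  where injectivity is visible levelwise.\<close>

lemma inj_mult_r: "inj_on (\<lambda>x. r \<otimes>\<^bsub>adic_ints p\<^esub> x) Zp"
proof (rule inj_onI)
  fix x z assume "x \<in> Zp" "z \<in> Zp" "r \<otimes>\<^bsub>adic_ints p\<^esub> x = r \<otimes>\<^bsub>adic_ints p\<^esub> z"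
  then show "x = z"
    by (metis psi_inv_closed psi_inv_mult_r inj_mult_s inj_onD psi_psi_inv)
qed

end

text \<open>At a multiple \<open>u z\<close> both sides equal \<open>f (b z)\<close>. Off the
  multiples of \<open>u\<close> the bijection lands off the multiples of \<open>r\<close>, so both
  vanish. Stated for two arbitrary bases, it serves \<open>\<psi>\<close> as well as
  \<open>\<psi>_inv\<close>.\<close>

lemma pullback_shift_endo:
  assumes b: "bij_betw b (carrier (adic_ints t)) (carrier (adic_ints s))"
    and mult: "\<And>y. y \<in> carrier (adic_ints t) \<Longrightarrow> b (u \<otimes>\<^bsub>adic_ints t\<^esub> y) = r \<otimes>\<^bsub>adic_ints s\<^esub> b y"
    and closed: "\<And>y. y \<in> carrier (adic_ints t) \<Longrightarrow> u \<otimes>\<^bsub>adic_ints t\<^esub> y \<in> carrier (adic_ints t)"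
    and inj: "inj_on (\<lambda>y. u \<otimes>\<^bsub>adic_ints t\<^esub> y) (carrier (adic_ints t))"
      "inj_on (\<lambda>x. r \<otimes>\<^bsub>adic_ints s\<^esub> x) (carrier (adic_ints s))"
  shows "pullback (carrier (adic_ints t)) b (shift_endo s r f)
    = shift_endo t u (pullback (carrier (adic_ints t)) b f)"
proof
  fix y
  let ?Y = "carrier (adic_ints t)" and ?X = "carrier (adic_ints s)"
  show "pullback ?Y b (shift_endo s r f) y = shift_endo t u (pullback ?Y b f) y"
  proof (cases "y \<in> (\<lambda>y. u \<otimes>\<^bsub>adic_ints t\<^esub> y) ` ?Y")
    case True
    then obtain z where z: "z \<in> ?Y" "y = u \<otimes>\<^bsub>adic_ints t\<^esub> z" by blast
    then have "b z \<in> ?X" using b bij_betwE by blast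
    with z show ?thesis
      by (simp add: pullback_def mult closed shift_endo_mult inj)
  next
    case False
    have "b y \<notin> (\<lambda>x. r \<otimes>\<^bsub>adic_ints s\<^esub> x) ` ?X" if "y \<in> ?Y"
    proof
      assume "b y \<in> (\<lambda>x. r \<otimes>\<^bsub>adic_ints s\<^esub> x) ` ?X"
      then obtain x where "x \<in> ?X" "b y = r \<otimes>\<^bsub>adic_ints s\<^esub> x" by blast
      moreover from this obtain z where "z \<in> ?Y" "x = b z"
        using b by (auto simp: bij_betw_def)
      ultimately have "b y = b (u \<otimes>\<^bsub>adic_ints t\<^esub> z)" "z \<in> ?Y"
        by (simp_all add: mult)
      with that closed b have "y = u \<otimes>\<^bsub>adic_ints t\<^esub> z"
        by (meson bij_betw_def inj_onD)
      with False \<open>z \<in> ?Y\<close> show False by blast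
    qed
    with False show ?thesis
      by (simp add: pullback_def shift_endo_zero)
  qed
qed

theorem proposition7p3:
  fixes p N :: nat and r r' :: "nat \<Rightarrow> int"
  assumes "prime p" and "odd p" and "N \<ge> 1"
    and "r' \<in> carrier (adic_ints p)" and "padic_norm p r' = 1"
    and "r = r' \<otimes>\<^bsub>adic_ints p\<^esub> adic_of_int p (int p ^ N)"
  shows "A_alg p r \<cong>\<^sub>C HS (p ^ N)"
proof -
  \<comment> \<open>The norm condition enters as the nonvanishing of \<open>r'\<close> modulo
    \<open>p\<close>.\<close>
  interpret adic_base_change p N "p ^ N" r r'
    using assms padic_norm_one_imp_unit by unfold_locales auto
  have "bij_betw \<psi> Zs Zp" "bij_betw \<psi>_inv Zp Zs"
    using homeomorphism_psi unfolding homeomorphism_def bij_betw_def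
    by (metis inj_on_inverseI)+
  then show ?thesis
    unfolding A_alg_def HS_def
    \<comment> \<open>\<open>of_nat_power\<close> is removed from the simplifier so that
      \<open>int (p ^ N)\<close> keeps the form it has in the interpreted facts.\<close>
    by (intro crossed_product_cfun_isomorphic[OF homeomorphism_psi] compact_adic_ints pullback_shift_endo)
      (simp_all add: psi_mult_s psi_inv_mult_r mult_s_closed mult_r_closed inj_mult_s inj_mult_r
        del: of_nat_power)
qed

end
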